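(* Every probabilistic recursive function is computable by a probabilistic Turing machine: $\mathscr{PR}\subseteq\mathscr{PC}$.
   Context: A pseudodistribution on a countable set $X$ is $\mathcal D:X\to[0,1]$ with $\sum_x\mathcal D(x)\le1$; $\mathcal D(X)$ is their set. A PF of arity $k$ is a function $\mathbb{N}^k\to\mathcal D(\mathbb{N})$. Basic PFs: $z(n)(0)=1$; $s(n)(n+1)=1$; $\Pi^n_m(k_1,\dots,k_n)(k_m)=1$; $r(x)(x)=r(x)(x+1)=1/2$ (other values $0$). Generalized composition $(f\odot(g_1,\dots,g_n))(\vec x)(y)=\sum_{z_1,\dots,z_n} f(z_1,\dots,z_n)(y)\prod_i g_i(\vec x)(z_i)$; primitive recursion $h=\mathrm{rec}(f,g)$: $h(\vec x,0)=f(\vec x)$, $h(\vec x,y+1)(w)=\sum_z h(\vec x,y)(z)\, g(\vec x,y,z)(w)$; minimization $\mu f(\vec x)(y)=f(\vec x,y)(0)\prod_{z<y}\sum_{k>0}f(\vec x,z)(k)$. $\mathscr{PR}$ is the smallest class of PFs containing the basic PFs and closed under these three operations. PTMs: Turing machines with tape alphabet $\Sigma_b\supseteq\{0,1\}$ plus blank, states $Q$, initial $q_s$, final states $Q_f$, and two transition functions $\delta_0,\delta_1$ on non-final configurations, each applied with probability $1/2$; configurations $\langle s,a,t,q\rangle$, initial configuration on $a\cdot v$ is $\langle\varepsilon,a,v,q_s\rangle$, final configuration with output $s$ is $\langle s,a,\varepsilon,q\rangle$, $q\in Q_f$. $\mathcal{IO}_M(s)(t)=\sum 2^{-|b|}$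 over choice sequences $b\in\{0,1\}^*$ that from the initial configuration on $s$ first reach a final configuration with output $t$ after exactly $|b|$ steps. With $n\mapsto\overline n$ the length-lexicographic bijection $\mathbb{N}\to\{0,1\}^*$ and $\langle\vec x\rangle$ a fixed computable string encoding of tuples, $\mathscr{PC}$ is the set of PFs $f$ with $f(\vec x)(y)=\mathcal{IO}_M(\langle\vec x\rangle)(\overline y)$ for some PTM $M$ and all $\vec x,y$. *)

theory Defs
  imports "HOL-Analysis.Analysis"
begin

text \<open>A PF of arity k is represented as a function from argument lists to
  (pseudo)distributions on nat; only its values on lists of length k matter.\<close>

type_synonym pf = "nat list \<Rightarrow> nat \<Rightarrow> real"

definition pseudodist :: "(nat \<Rightarrow> real) \<Rightarrow> bool" where
  "pseudodist D \<longleftrightarrow> (\<forall>x. 0 \<le> D x \<and> D x \<le> 1) \<and> D summable_on UNIV \<and> (\<Sum>\<^sub>\<infinity>x. D x) \<le> 1"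

definition pf_zero :: pf where
  "pf_zero xs y = (if y = 0 then 1 else 0)"

definition pf_succ :: pf where
  "pf_succ xs y = (if y = hd xs + 1 then 1 else 0)"

definition pf_proj :: "nat \<Rightarrow> pf" where
  "pf_proj m xs y = (if y = xs ! (m - 1) then 1 else 0)"

definition pf_rand :: pf where
  "pf_rand xs y = (if y = hd xs \<or> y = hd xs + 1 then 1/2 else 0)"

definition pf_comp :: "pf \<Rightarrow> pf list \<Rightarrow> pf" where
  "pf_comp f gs xs y =
     (\<Sum>\<^sub>\<infinity>zs\<in>{zs. length zs = length gs}. f zs y * (\<Prod>i<length gs. (gs ! i) xs (zs ! i)))"

fun rec_aux :: "pf \<Rightarrow> pf \<Rightarrow> nat list \<Rightarrow> nat \<Rightarrow> nat \<Rightarrow> real" where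
  "rec_aux f g xs 0 = f xs"
| "rec_aux f g xs (Suc n) = (\<lambda>w. \<Sum>\<^sub>\<infinity>z. rec_aux f g xs n z * g (xs @ [n, z]) w)"

definition pf_rec :: "pf \<Rightarrow> pf \<Rightarrow> pf" where
  "pf_rec f g xs = rec_aux f g (butlast xs) (last xs)"

definition pf_mu :: "pf \<Rightarrow> pf" where
  "pf_mu f xs y = f (xs @ [y]) 0 * (\<Prod>z<y. \<Sum>\<^sub>\<infinity>k\<in>{0<..}. f (xs @ [z]) k)"

inductive PR :: "nat \<Rightarrow> pf \<Rightarrow> bool" where
  PR_zero: "PR 1 pf_zero"
| PR_succ: "PR 1 pf_succ"
| PR_proj: "1 \<le> m \<Longrightarrow> m \<le> n \<Longrightarrow> PR n (pf_proj m)"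
| PR_rand: "PR 1 pf_rand"
| PR_comp: "PR n f \<Longrightarrow> length gs = n \<Longrightarrow> (\<forall>g\<in>set gs. PR k g) \<Longrightarrow> PR k (pf_comp f gs)"
| PR_rec: "PR k f \<Longrightarrow> PR (k + 2) g \<Longrightarrow> PR (k + 1) (pf_rec f g)"
| PR_mu: "PR (k + 1) f \<Longrightarrow> PR k (pf_mu f)"

text \<open>Tape symbols: the blank, and symbols \<open>Sy n\<close>; \<open>Sy 0\<close> and \<open>Sy 1\<close> are the bits.\<close>
datatype sym = Blank | Sy nat

datatype move = MoveL | MoveR

text \<open>Configuration \<open>\<langle>s, a, t, q\<rangle>\<close>: left part s (left to right), scanned symbol a,
  right part t, state q. Tapes are blank outside the represented part; the
  representation is kept canonical (no leading blanks in s, no trailing blanks in t).\<close>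
type_synonym config = "sym list \<times> sym \<times> sym list \<times> nat"

record ptm =
  alphabet :: "nat set"
  states :: "nat set"
  init_state :: nat
  final_states :: "nat set"
  delta0 :: "nat \<Rightarrow> sym \<Rightarrow> nat \<times> sym \<times> move"
  delta1 :: "nat \<Rightarrow> sym \<Rightarrow> nat \<times> sym \<times> move"

definition tape_syms :: "ptm \<Rightarrow> sym set" where
  "tape_syms M = insert Blank (Sy ` alphabet M)"

definition wf_ptm :: "ptm \<Rightarrow> bool" where
  "wf_ptm M \<longleftrightarrow> finite (alphabet M) \<and> {0, 1} \<subseteq> alphabet M \<and>
     finite (states M) \<and> init_state M \<in> states M \<and> final_states M \<subseteq> states M \<and>
     (\<forall>q \<in> states M - final_states M. \<forall>a \<in> tape_syms M.
        (\<lambda>(q', b, d). q' \<in> states M \<and> b \<in> tape_syms M) (delta0 M q a) \<and>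
        (\<lambda>(q', b, d). q' \<in> states M \<and> b \<in> tape_syms M) (delta1 M q a))"

definition apply_trans :: "nat \<times> sym \<times> move \<Rightarrow> config \<Rightarrow> config" where
  "apply_trans tr c = (case tr of (q', b, d) \<Rightarrow> (case c of (s, a, t, q) \<Rightarrow>
     (case d of
        MoveL \<Rightarrow> (let t' = (if b = Blank \<and> t = [] then [] else b # t) in
                   if s = [] then ([], Blank, t', q') else (butlast s, last s, t', q'))
      | MoveR \<Rightarrow> (let s' = (if b = Blank \<and> s = [] then [] else s @ [b]) in
                   if t = [] then (s', Blank, [], q') else (s', hd t, tl t, q')))))"

definition step :: "ptm \<Rightarrow> bool \<Rightarrow> config \<Rightarrow> config" where
  "step M ch c = (case c of (s, a, t, q) \<Rightarrow>
     apply_trans ((if ch then delta1 M else delta0 M) q a) c)"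

definition is_final :: "ptm \<Rightarrow> config \<Rightarrow> bool" where
  "is_final M c = (case c of (s, a, t, q) \<Rightarrow> q \<in> final_states M)"

text \<open>Run along a sequence of choices; \<open>None\<close> if a final state is met before
  the choice sequence is exhausted (so only first arrivals are counted).\<close>
fun run :: "ptm \<Rightarrow> config \<Rightarrow> bool list \<Rightarrow> config option" where
  "run M c [] = Some c"
| "run M c (b # bs) = (if is_final M c then None else run M (step M b c) bs)"

definition initial_config :: "ptm \<Rightarrow> sym list \<Rightarrow> config" where
  "initial_config M w = (case w of [] \<Rightarrow> ([], Blank, [], init_state M)
                                | a # v \<Rightarrow> ([], a, v, init_state M))"

definition final_with_output :: "ptm \<Rightarrow> config \<Rightarrow> sym list \<Rightarrow> bool" where
  "final_with_output M c out = (case c of (s, a, t, q) \<Rightarrow>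
     q \<in> final_states M \<and> t = [] \<and> s = out)"

definition IO :: "ptm \<Rightarrow> sym list \<Rightarrow> sym list \<Rightarrow> real" where
  "IO M s out = (\<Sum>\<^sub>\<infinity>bs\<in>{bs. \<exists>c. run M (initial_config M s) bs = Some c \<and>
                                   final_with_output M c out}. (1/2) ^ length bs)"

text \<open>Length-lexicographic bijection \<open>n \<mapsto> \<overline>n\<close>: 0 \<mapsto> \<epsilon>, 1 \<mapsto> 0, 2 \<mapsto> 1, 3 \<mapsto> 00, ...\<close>
fun bin :: "nat \<Rightarrow> nat list" where
  "bin 0 = []"
| "bin (Suc n) = bin (n div 2) @ [n mod 2]"

definition bin_str :: "nat \<Rightarrow> sym list" where
  "bin_str n = map Sy (bin n)"

definition enc_tuple :: "nat list \<Rightarrow> sym list" where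
  "enc_tuple xs = map Sy (concat (map (\<lambda>x. concat (map (\<lambda>b. [b, b]) (bin x)) @ [0, 1]) xs))"

definition PC :: "nat \<Rightarrow> pf \<Rightarrow> bool" where
  "PC k f \<longleftrightarrow> (\<exists>M. wf_ptm M \<and>
     (\<forall>xs y. length xs = k \<longrightarrow> f xs y = IO M (enc_tuple xs) (bin_str y)))"

end

theory Submission
  imports Defs
begin

text \<open>Functions are compiled to a small imperative language over finitely many counters and a
  stack of bits, with coin tossing.  The semantics of a program is its weakest pre-expectation
  with values in the extended nonnegative reals; loops are least fixed points, so probability
  lost to divergence needs no separate treatment.

  A Turing machine runs a program with the list of pending commands as its control state; only
  finitely many such lists occur.  The stack is the part of the tape to the left of a home cell,
  its top at the far left end, and the counters are kept in unary on parallel tracks that start at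
  the home cell.  The input is thus the initial stack, and a final stack over cleared counters is
  already an output configuration.  The probability of an output satisfies the equations that
  define the pre-expectation, and its finite approximations lie below the pre-expectation, so the
  two agree.\<close>

text \<open>The output probability and the pre-expectation are matched by two one-sided arguments of
  different kinds. The upper bound is an induction on the number of machine steps allowed: every
  command costs at least one step, so what remains to be executed falls under the induction
  hypothesis. The lower bound is an induction on the command; a loop is settled because the output
  probability is a pre-fixed point of the functional whose least fixed point defines the loop.

  The obstacle on the compiler side is the reuse of registers, since a subprogram leaves garbage in
  its scratch registers. Specifications are therefore relative to a bound \<open>b\<close> and speak
  only of expectations that ignore the registers from \<open>b\<close> on; inside loops this
  indifference must itself be proved.

  Sums are taken in the extended nonnegative reals, where they may be exchanged freely. The real
  sums of the definitions are recovered afterwards: an implementable function has total mass at most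
  1, because the pre-expectation of the constant 1 never exceeds 1.\<close>

section \<open>The command language and its pre-expectation semantics\<close>

datatype cmd = Inc nat | Dec nat | Toss nat | Push bool | Pop nat
  | Seq cmd cmd | Cond nat cmd cmd | While nat cmd

text \<open>Machine states are natural numbers, so control states built from command lists are coded
  with \<open>to_nat\<close>.\<close>

instance cmd :: countable
  by countable_datatype

type_synonym state = "bool list \<times> (nat \<Rightarrow> nat)"

primrec wp :: "cmd \<Rightarrow> (state \<Rightarrow> ennreal) \<Rightarrow> state \<Rightarrow> ennreal" where
  "wp (Inc i) F = (\<lambda>(st, \<sigma>). F (st, \<sigma>(i := Suc (\<sigma> i))))"
| "wp (Dec i) F = (\<lambda>(st, \<sigma>). F (st, \<sigma>(i := \<sigma> i - 1)))"
| "wp (Toss i) F = (\<lambda>(st, \<sigma>). (F (st, \<sigma>(i := Suc (\<sigma> i))) + F (st, \<sigma>)) / 2)"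
| "wp (Push b) F = (\<lambda>(st, \<sigma>). F (b # st, \<sigma>))"
| "wp (Pop i) F = (\<lambda>(st, \<sigma>). F (tl st, if st \<noteq> [] \<and> hd st then \<sigma>(i := Suc (\<sigma> i)) else \<sigma>))"
| "wp (Seq c d) F = wp c (wp d F)"
| "wp (Cond i c d) F = (\<lambda>s. if snd s i = 0 then wp d F s else wp c F s)"
| "wp (While i c) F = lfp (\<lambda>W s. if snd s i = 0 then F s else wp c W s)"

lemma ennreal_half_mono: "(a::ennreal) \<le> b \<Longrightarrow> a / 2 \<le> b / 2"
  by (rule divide_right_mono_ennreal)

lemma wp_mono: "F \<le> G \<Longrightarrow> wp c F \<le> wp c G"
proof (induction c arbitrary: F G)
  case (Toss i)
  then show ?case
    by (auto simp: le_fun_def intro!: ennreal_half_mono add_mono)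
next
  case (Seq c d)
  then show ?case by simp
next
  case (While i c)
  then have "(\<lambda>s. if snd s i = 0 then F s else wp c W s) \<le> (\<lambda>s. if snd s i = 0 then G s else wp c W s)" for W
    by (auto simp: le_fun_def)
  then show ?case
    unfolding wp.simps by (rule lfp_mono)
qed (auto simp: le_fun_def)

lemma mono_while_body: "mono (\<lambda>W s. if snd s i = 0 then F s else wp c W s)"
  using wp_mono by (fastforce intro!: monoI simp: le_fun_def)

lemma wp_While_unfold:
  "wp (While i c) F s = (if snd s i = 0 then F s else wp c (wp (While i c) F) s)"
  unfolding wp.simps by (subst lfp_unfold[OF mono_while_body]) simp

lemma wp_While_0 [simp]: "\<sigma> i = 0 \<Longrightarrow> wp (While i c) F (st, \<sigma>) = F (st, \<sigma>)"
  by (subst wp_While_unfold) simp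

lemma wp_While_Suc: "\<sigma> i \<noteq> 0 \<Longrightarrow> wp (While i c) F (st, \<sigma>) = wp c (wp (While i c) F) (st, \<sigma>)"
  by (subst wp_While_unfold) simp

text \<open>For a loop, the constant 1 is a pre-fixed point. This is the source of the mass bound
  \<open>implementable_mass\<close>, on which summability rests later.\<close>

lemma wp_le_1: "F \<le> (\<lambda>_. 1) \<Longrightarrow> wp c F \<le> (\<lambda>_. 1)"
proof (induction c arbitrary: F)
  case (Toss i)
  have "(a + b) / 2 \<le> 1" if "a \<le> 1" "b \<le> 1" for a b :: ennreal
  proof -
    have "(a + b) / 2 \<le> (1 + 1) / 2"
      using that by (intro ennreal_half_mono add_mono)
    also have "\<dots> = (1 :: ennreal)" by simp
    finally show ?thesis .
  qed
  with Toss show ?case by (auto simp: le_fun_def)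
next
  case (While i c)
  then have "(\<lambda>s. if snd s i = 0 then F s else wp c (\<lambda>_. 1) s) \<le> (\<lambda>_. 1)"
    by (auto simp: le_fun_def)
  then show ?case unfolding wp.simps by (rule lfp_lowerbound)
qed (auto simp: le_fun_def)

text \<open>Loops stay folded from here on and are unrolled one round at a time; the least fixed
  point is exposed only where its leastness is used.\<close>

declare wp.simps(8) [simp del]

primrec wps :: "cmd list \<Rightarrow> (state \<Rightarrow> ennreal) \<Rightarrow> state \<Rightarrow> ennreal" where
  "wps [] F = F"
| "wps (c # k) F = wp c (wps k F)"

primrec regs :: "cmd \<Rightarrow> nat set" where
  "regs (Inc i) = {i}"
| "regs (Dec i) = {i}"
| "regs (Toss i) = {i}"
| "regs (Push b) = {}"
| "regs (Pop i) = {i}"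
| "regs (Seq c d) = regs c \<union> regs d"
| "regs (Cond i c d) = {i} \<union> regs c \<union> regs d"
| "regs (While i c) = {i} \<union> regs c"

lemma finite_regs: "finite (regs c)"
  by (induction c) auto

subsection \<open>Probability of reaching an output\<close>

text \<open>Inspecting a final configuration also consumes a unit of the budget, so budget
  \<open>n\<close> covers exactly the choice sequences of length less than \<open>n\<close>; see
  \<open>acc_eq_sum\<close>.\<close>

fun acc :: "ptm \<Rightarrow> sym list \<Rightarrow> nat \<Rightarrow> config \<Rightarrow> ennreal" where
  "acc M w 0 c = 0"
| "acc M w (Suc n) c =
     (if is_final M c then (if final_with_output M c w then 1 else 0)
      else (acc M w n (step M True c) + acc M w n (step M False c)) / 2)"

definition val :: "ptm \<Rightarrow> sym list \<Rightarrow> config \<Rightarrow> ennreal" where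
  "val M w c = (SUP n. acc M w n c)"

lemma acc_Suc_mono: "acc M w n c \<le> acc M w (Suc n) c"
proof (induction n arbitrary: c)
  case (Suc n)
  have "(acc M w n (step M True c) + acc M w n (step M False c)) / 2 \<le>
      (acc M w (Suc n) (step M True c) + acc M w (Suc n) (step M False c)) / 2"
    by (intro ennreal_half_mono add_mono Suc)
  then show ?case
    by (subst (1 2) acc.simps(2)) (simp del: acc.simps)
qed simp

lemma acc_mono: "incseq (\<lambda>n. acc M w n c)"
  by (rule incseq_SucI) (rule acc_Suc_mono)

lemma acc_le_val: "acc M w n c \<le> val M w c"
  unfolding val_def by (rule SUP_upper) simp

lemma SUP_Suc_incseq:
  fixes f :: "nat \<Rightarrow> ennreal"
  assumes "incseq f"
  shows "(SUP n. f (Suc n)) = (SUP n. f n)"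
proof (rule antisym)
  show "(SUP n. f (Suc n)) \<le> (SUP n. f n)"
    by (rule SUP_mono) auto
  show "(SUP n. f n) \<le> (SUP n. f (Suc n))"
  proof (rule SUP_mono)
    show "\<exists>m\<in>UNIV. f n \<le> f (Suc m)" for n
      using assms by (intro bexI[of _ n]) (auto simp: incseq_def)
  qed
qed

lemma val_final:
  "is_final M c \<Longrightarrow> val M w c = (if final_with_output M c w then 1 else 0)"
  unfolding val_def SUP_Suc_incseq[OF acc_mono, symmetric] by simp

text \<open>Halving commutes with suprema, and the supremum of the sum splits because both sequences
  increase with the budget.\<close>

lemma val_step:
  assumes "\<not> is_final M c"
  shows "val M w c = (val M w (step M True c) + val M w (step M False c)) / 2"
proof -
  have "val M w c = (SUP n. (acc M w n (step M True c) + acc M w n (step M False c)) / 2)"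
    unfolding val_def SUP_Suc_incseq[OF acc_mono, symmetric] using assms by simp
  also have "\<dots> = (SUP n. acc M w n (step M True c) + acc M w n (step M False c)) / 2"
    unfolding divide_ennreal_def by (rule SUP_mult_right_ennreal[symmetric])
  also have "\<dots> = (val M w (step M True c) + val M w (step M False c)) / 2"
    unfolding val_def by (subst ennreal_SUP_add[OF acc_mono acc_mono]) simp
  finally show ?thesis .
qed

text \<open>Among the transitions of the compiled machine only those for \<open>Toss\<close> consult
  the choice. All other moves are covered by this relation, along which \<open>val\<close> is
  constant.\<close>

definition dstep :: "ptm \<Rightarrow> config \<Rightarrow> config \<Rightarrow> bool" where
  "dstep M c c' \<longleftrightarrow> \<not> is_final M c \<and> (\<forall>ch. step M ch c = c')"

lemma ennreal_half_twice: "(x + x) / 2 = (x::ennreal)"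
  by (simp add: mult_2[symmetric] mult.commute[of 2] mult_divide_eq_ennreal)

lemma acc_dstep: "dstep M c c' \<Longrightarrow> acc M w (Suc n) c = acc M w n c'"
  by (simp add: dstep_def ennreal_half_twice)

lemma val_dstep: "dstep M c c' \<Longrightarrow> val M w c = val M w c'"
  by (simp add: dstep_def val_step ennreal_half_twice)

lemma val_dsteps: "(dstep M)\<^sup>*\<^sup>* c c' \<Longrightarrow> val M w c = val M w c'"
  by (induction rule: rtranclp_induct) (auto simp: val_dstep)

lemma acc_dsteps: "(dstep M)\<^sup>*\<^sup>* c c' \<Longrightarrow> acc M w n c \<le> acc M w n c'"
proof (induction rule: converse_rtranclp_induct)
  case (step y z)
  have "acc M w n y \<le> acc M w (Suc n) y" by (rule acc_Suc_mono)
  also have "\<dots> = acc M w n z" by (rule acc_dstep[OF step(1)])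
  also have "\<dots> \<le> acc M w n c'" by (rule step.IH)
  finally show ?case .
qed simp

text \<open>The first step lowers the budget, and the later ones do no harm. This decrease drives
  the induction in \<open>acc_le_wps\<close>.\<close>

lemma acc_dsteps1: "(dstep M)\<^sup>+\<^sup>+ c c' \<Longrightarrow> acc M w (Suc n) c \<le> acc M w n c'"
  by (metis acc_dstep acc_dsteps tranclpD)

subsection \<open>The outputs of a run as a sum over choice sequences\<close>

text \<open>\<open>infsum\<close> is 0 on families that are not summable, so finiteness has to be
  secured before the two notions of sum agree.\<close>

lemma ennreal_infsum:
  fixes h :: "'a \<Rightarrow> real"
  assumes nonneg: "\<And>x. x \<in> A \<Longrightarrow> 0 \<le> h x"
    and fin: "(\<integral>\<^sup>+x. ennreal (h x) \<partial>count_space A) < \<infinity>"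
  shows "ennreal (\<Sum>\<^sub>\<infinity>x\<in>A. h x) = (\<integral>\<^sup>+x. ennreal (h x) \<partial>count_space A)"
proof -
  have "integrable (count_space A) h"
    using assms by (intro integrableI_nonneg) (auto simp: AE_count_space)
  then have abs: "Infinite_Set_Sum.abs_summable_on h A"
    by (simp add: Infinite_Set_Sum.abs_summable_on_def)
  have "(\<integral>\<^sup>+x. ennreal (h x) \<partial>count_space A) = ennreal (infsetsum h A)"
    by (rule nn_integral_conv_infsetsum[OF abs nonneg])
  with abs show ?thesis by (simp add: infsetsum_infsum)
qed

definition choices :: "ptm \<Rightarrow> sym list \<Rightarrow> config \<Rightarrow> bool list set" where
  "choices M w c = {bs. \<exists>c'. run M c bs = Some c' \<and> final_with_output M c' w}"

lemma final_with_output_final: "final_with_output M c w \<Longrightarrow> is_final M c"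
  by (auto simp: final_with_output_def is_final_def split: prod.splits)

lemma choices_final:
  assumes "is_final M c"
  shows "choices M w c = (if final_with_output M c w then {[]} else {})"
proof -
  have "bs = []" if "run M c bs = Some c'" for bs c'
    using that assms by (cases bs) auto
  then have "choices M w c = {bs. bs = [] \<and> final_with_output M c w}"
    unfolding choices_def by (metis (lifting) option.inject run.simps(1))
  then show ?thesis by auto
qed

text \<open>The empty sequence leads to no output from a configuration that is not final, so every
  sequence counted has a first choice.\<close>

lemma choices_step:
  assumes "\<not> is_final M c"
  shows "choices M w c =
    Cons True ` choices M w (step M True c) \<union> Cons False ` choices M w (step M False c)"
proof -
  have "bs \<in> choices M w c \<longleftrightarrow> bs \<in> Cons True ` choices M w (step M True c) \<union>
      Cons False ` choices M w (step M False c)" for bs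
  proof (cases bs)
    case Nil
    with assms show ?thesis
      by (auto simp: choices_def dest: final_with_output_final)
  next
    case (Cons b bs')
    with assms show ?thesis
      by (cases b) (auto simp: choices_def)
  qed
  then show ?thesis by blast
qed

text \<open>Sequences are split by their first choice into two disjoint sets; prefixing that choice
  halves the weight.\<close>

lemma acc_eq_sum:
  "acc M w n c = (\<Sum>bs\<in>{bs\<in>choices M w c. length bs < n}. ennreal ((1/2) ^ length bs))"
proof (induction n arbitrary: c)
  case (Suc n)
  show ?case
  proof (cases "is_final M c")
    case True
    have "{bs \<in> choices M w c. length bs < Suc n} = choices M w c"
      using True by (auto simp: choices_final)
    then show ?thesis using True by (simp add: choices_final)
  next
    case False
    define S where "S b = {bs \<in> choices M w (step M b c). length bs < n}" for b
    have fin: "finite (S b)" for b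
      by (rule finite_subset[OF _ finite_lists_length_le[of "UNIV::bool set" n]])
         (auto simp: S_def)
    have "{bs \<in> choices M w c. length bs < Suc n} = Cons True ` S True \<union> Cons False ` S False"
      using False by (auto simp: choices_step S_def)
    then have split: "(\<Sum>bs\<in>{bs\<in>choices M w c. length bs < Suc n}. ennreal ((1/2) ^ length bs)) =
        (\<Sum>bs\<in>Cons True ` S True. ennreal ((1/2) ^ length bs)) +
        (\<Sum>bs\<in>Cons False ` S False. ennreal ((1/2) ^ length bs))"
      using fin by (simp only:) (rule sum.union_disjoint, auto)
    have part: "(\<Sum>bs\<in>Cons b ` S b. ennreal ((1/2) ^ length bs)) = acc M w n (step M b c) / 2" for b
    proof -
      have half: "ennreal (r * (1/2)) = ennreal r * inverse 2" if "0 \<le> r" for r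
        using that by (subst ennreal_mult) auto
      have "(\<Sum>bs\<in>Cons b ` S b. ennreal ((1/2) ^ length bs)) =
          (\<Sum>bs\<in>S b. ennreal ((1/2) ^ length bs) * inverse 2)"
        unfolding sum.reindex[OF inj_on_Cons1] using half by (intro sum.cong) auto
      also have "\<dots> = acc M w n (step M b c) * inverse 2"
        unfolding Suc S_def sum_distrib_right ..
      finally show ?thesis by (simp add: divide_ennreal_def)
    qed
    show ?thesis
      unfolding split part using False by (simp add: divide_ennreal_def distrib_right)
  qed
qed simp

lemma acc_le_1: "acc M w n c \<le> 1"
proof (induction n arbitrary: c)
  case (Suc n)
  have "(acc M w n (step M True c) + acc M w n (step M False c)) / 2 \<le> (1 + 1) / 2"
    by (intro ennreal_half_mono add_mono Suc)
  then show ?case by simp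
qed simp

text \<open>Cutting the sum off at length \<open>n\<close> gives \<open>acc\<close>, and monotone
  convergence in \<open>n\<close> gives \<open>val\<close>.\<close>

lemma ennreal_IO: "ennreal (IO M s w) = val M w (initial_config M s)"
proof -
  let ?S = "choices M w (initial_config M s)"
  let ?h = "\<lambda>bs::bool list. (1/2::real) ^ length bs"
  have "(\<integral>\<^sup>+bs. ennreal (?h bs) \<partial>count_space ?S) =
      (\<integral>\<^sup>+bs. (SUP n. ennreal (?h bs) * indicator {bs. length bs < n} bs) \<partial>count_space ?S)"
  proof (rule nn_integral_cong)
    fix bs :: "bool list"
    have "(SUP n. ennreal (?h bs) * indicator {bs. length bs < n} bs) = ennreal (?h bs)"
    proof (rule antisym)
      show "(SUP n. ennreal (?h bs) * indicator {bs. length bs < n} bs) \<le> ennreal (?h bs)"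
        by (intro SUP_least) (auto simp: indicator_def)
      show "ennreal (?h bs) \<le> (SUP n. ennreal (?h bs) * indicator {bs. length bs < n} bs)"
        by (rule SUP_upper2[of "Suc (length bs)"]) auto
    qed
    then show "ennreal (?h bs) = (SUP n. ennreal (?h bs) * indicator {bs. length bs < n} bs)" ..
  qed
  also have "\<dots> = (SUP n. \<integral>\<^sup>+bs. ennreal (?h bs) * indicator {bs. length bs < n} bs \<partial>count_space ?S)"
    by (rule nn_integral_monotone_convergence_SUP)
       (auto simp: incseq_def le_fun_def indicator_def)
  also have "\<dots> = (SUP n. acc M w n (initial_config M s))"
  proof (rule SUP_cong[OF refl])
    fix n
    let ?T = "{bs \<in> ?S. length bs < n}"
    have fin: "finite ?T"
      by (rule finite_subset[OF _ finite_lists_length_le[of "UNIV::bool set" n]]) auto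
    have "(\<integral>\<^sup>+bs. ennreal (?h bs) * indicator {bs. length bs < n} bs \<partial>count_space ?S) =
        (\<Sum>bs\<in>?T. ennreal (?h bs) * indicator {bs. length bs < n} bs)"
      by (rule nn_integral_count_space'[OF fin]) (auto simp: indicator_def)
    also have "\<dots> = acc M w n (initial_config M s)"
      unfolding acc_eq_sum by (rule sum.cong) auto
    finally show "(\<integral>\<^sup>+bs. ennreal (?h bs) * indicator {bs. length bs < n} bs \<partial>count_space ?S) =
        acc M w n (initial_config M s)" .
  qed
  finally have eq: "(\<integral>\<^sup>+bs. ennreal (?h bs) \<partial>count_space ?S) = val M w (initial_config M s)"
    by (simp add: val_def)
  have "val M w (initial_config M s) \<le> 1"
    unfolding val_def by (rule SUP_least) (rule acc_le_1)
  then have "val M w (initial_config M s) < \<infinity>"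
    using le_less_trans by fastforce
  then have "ennreal (\<Sum>\<^sub>\<infinity>bs\<in>?S. ?h bs) = val M w (initial_config M s)"
    by (subst ennreal_infsum) (auto simp: eq)
  then show ?thesis by (simp add: IO_def choices_def)
qed

subsection \<open>Tapes\<close>

definition eventually_blank :: "(nat \<Rightarrow> sym) \<Rightarrow> bool" where
  "eventually_blank g \<longleftrightarrow> (\<exists>n. \<forall>j\<ge>n. g j = Blank)"

text \<open>The canonical list form of a half tape. Tapes are handled as functions, which avoids
  case distinctions at the end of the list, and are trimmed only when a configuration is
  formed.\<close>

definition trim :: "(nat \<Rightarrow> sym) \<Rightarrow> sym list" where
  "trim g = map g [0..<LEAST n. \<forall>j\<ge>n. g j = Blank]"

abbreviation scons :: "sym \<Rightarrow> (nat \<Rightarrow> sym) \<Rightarrow> nat \<Rightarrow> sym" where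
  "scons b g \<equiv> case_nat b g"

abbreviation sapp :: "sym list \<Rightarrow> (nat \<Rightarrow> sym) \<Rightarrow> nat \<Rightarrow> sym" where
  "sapp xs g \<equiv> foldr scons xs g"

lemma scons_0_Suc: "scons (g 0) (g \<circ> Suc) = g"
  by (rule ext) (simp split: nat.split)

lemma scons_comp_Suc [simp]: "scons b g \<circ> Suc = g"
  by (rule ext) simp

lemma eventually_blank_scons [simp]: "eventually_blank (scons b g) \<longleftrightarrow> eventually_blank g"
proof
  assume "eventually_blank (scons b g)"
  then obtain n where "\<forall>j\<ge>n. scons b g j = Blank" by (auto simp: eventually_blank_def)
  then have "\<forall>j\<ge>n. g j = Blank" by (metis le_Suc_eq nat.case(2))
  then show "eventually_blank g" by (auto simp: eventually_blank_def)
next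
  assume "eventually_blank g"
  then obtain n where "\<forall>j\<ge>n. g j = Blank" by (auto simp: eventually_blank_def)
  then have "\<forall>j\<ge>Suc n. scons b g j = Blank" by (auto split: nat.split)
  then show "eventually_blank (scons b g)" unfolding eventually_blank_def by blast
qed

lemma eventually_blank_Suc [simp]: "eventually_blank (g \<circ> Suc) \<longleftrightarrow> eventually_blank g"
  by (metis scons_0_Suc eventually_blank_scons)

lemma eventually_blank_sapp [simp]: "eventually_blank (sapp xs g) \<longleftrightarrow> eventually_blank g"
  by (induction xs) auto

text \<open>The least bound moves up by one, except when the extended tape is entirely blank, where
  both bounds are 0.\<close>

lemma trim_scons:
  assumes "eventually_blank h"
  shows "trim (scons b h) = (if b = Blank \<and> trim h = [] then [] else b # trim h)"
proof -
  let ?P = "\<lambda>n. \<forall>j\<ge>n. h j = Blank" and ?Q = "\<lambda>n. \<forall>j\<ge>n. scons b h j = Blank"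
  obtain n where n: "?P n" using assms by (auto simp: eventually_blank_def)
  have QS: "?Q (Suc n) \<longleftrightarrow> ?P n" for n
    by (metis Suc_le_D Suc_le_mono nat.case(2))
  show ?thesis
  proof (cases "b = Blank \<and> trim h = []")
    case True
    then have "(LEAST n. ?P n) = 0" by (simp add: trim_def)
    then have "?P 0" using LeastI[of ?P n] n by metis
    with True have "?Q 0" by (auto split: nat.split)
    then have "(LEAST n. ?Q n) = 0" by (intro Least_equality) auto
    then have "trim (scons b h) = []" by (simp add: trim_def)
    with True show ?thesis by simp
  next
    case False
    have "\<not> ?Q 0"
    proof
      assume *: "?Q 0"
      then have "b = Blank" by (metis nat.case(1) le0)
      moreover have "?P 0" using * by (metis nat.case(2) le0)
      then have "(LEAST n. ?P n) = 0" by (intro Least_equality) auto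
      ultimately show False using False by (simp add: trim_def)
    qed
    then have "(LEAST n. ?Q n) = Suc (LEAST n. ?Q (Suc n))"
      using QS[of n] n by (intro Least_Suc[of _ "Suc n"]) auto
    also have "\<dots> = Suc (LEAST n. ?P n)" by (simp only: QS)
    finally have *: "(LEAST n. ?Q n) = Suc (LEAST n. ?P n)" .
    have "trim (scons b h) = b # trim h"
      unfolding trim_def * upt_conv_Cons[OF zero_less_Suc] map_Suc_upt[symmetric] by simp
    with False show ?thesis by auto
  qed
qed

lemma trim_blank [simp]: "trim (\<lambda>_. Blank) = []"
  by (simp add: trim_def)

lemma hd_trim: "eventually_blank g \<Longrightarrow> (if trim g = [] then Blank else hd (trim g)) = g 0"
  using trim_scons[of "g \<circ> Suc" "g 0"] by (auto simp: scons_0_Suc)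

lemma tl_trim: "eventually_blank g \<Longrightarrow> tl (trim g) = trim (g \<circ> Suc)"
  using trim_scons[of "g \<circ> Suc" "g 0"] by (auto simp: scons_0_Suc)

lemma trim_sapp: "Blank \<notin> set xs \<Longrightarrow> trim (sapp xs (\<lambda>_. Blank)) = xs"
proof (induction xs)
  case (Cons x xs)
  have "eventually_blank (\<lambda>_. Blank)"
    by (simp add: eventually_blank_def)
  with Cons show ?case by (auto simp: trim_scons)
qed simp

text \<open>The left part stays a list: at the home cell it is the stack itself, which in the end is
  compared literally with the output word.\<close>

definition conf :: "sym list \<Rightarrow> (nat \<Rightarrow> sym) \<Rightarrow> nat \<Rightarrow> config" where
  "conf L g q = (L, g 0, trim (g \<circ> Suc), q)"

lemma apply_MoveR:
  assumes "eventually_blank g"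
  shows "apply_trans (q', b, MoveR) (conf L g q) =
    conf (if b = Blank \<and> L = [] then [] else L @ [b]) (g \<circ> Suc) q'"
  using hd_trim[of "g \<circ> Suc"] tl_trim[of "g \<circ> Suc"] assms
  by (auto simp: apply_trans_def conf_def Let_def split: if_splits)

lemma apply_MoveL_Nil:
  assumes "eventually_blank g"
  shows "apply_trans (q', b, MoveL) (conf [] g q) = conf [] (scons Blank (scons b (g \<circ> Suc))) q'"
  using assms by (auto simp: apply_trans_def conf_def Let_def trim_scons)

lemma apply_MoveL_snoc:
  assumes "eventually_blank g"
  shows "apply_trans (q', b, MoveL) (conf (L @ [x]) g q) = conf L (scons x (scons b (g \<circ> Suc))) q'"
  using assms by (auto simp: apply_trans_def conf_def Let_def trim_scons)

subsection \<open>The machine of a program\<close>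

text \<open>\<open>Home\<close> executes the first pending command. \<open>Aux\<close> walks to the
  far end of the stack, or examines the last mark of a counter; \<open>Aux2\<close> inspects the
  symbol to be popped. \<open>Back\<close> returns leftwards through the marked cells,
  \<open>Forth\<close> rightwards over the stack.\<close>

datatype phase = Home | Aux | Aux2 | Back | Forth

instance phase :: countable
  by countable_datatype

fun is_bit :: "sym \<Rightarrow> bool" where
  "is_bit Blank = False"
| "is_bit (Sy n) = (n \<le> 1)"

definition bsym :: "bool \<Rightarrow> sym" where
  "bsym b = Sy (if b then 1 else 0)"

text \<open>A nonempty finite set has a positive code, so its symbol is at least \<open>Sy 2\<close>
  and differs from both bits. The empty set is the blank, which keeps the tape blank beyond the
  largest counter.\<close>

definition mark :: "nat set \<Rightarrow> sym" where
  "mark S = (if S = {} then Blank else Sy (Suc (set_encode S)))"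

fun tracks :: "sym \<Rightarrow> nat set" where
  "tracks Blank = {}"
| "tracks (Sy n) = (if n \<le> 1 then {} else set_decode (n - 1))"

lemma is_bit_bsym [simp]: "is_bit (bsym b)"
  by (simp add: bsym_def)

lemma bsym_ne_Blank [simp]: "bsym b \<noteq> Blank" "Blank \<noteq> bsym b"
  by (simp_all add: bsym_def)

lemma bsym_eq_iff [simp]: "bsym b = bsym c \<longleftrightarrow> b = c"
  by (simp add: bsym_def)

lemma tracks_bsym [simp]: "tracks (bsym b) = {}"
  by (simp add: bsym_def)

lemma set_encode_pos: "finite S \<Longrightarrow> S \<noteq> {} \<Longrightarrow> set_encode S \<noteq> 0"
  by (metis set_encode_inverse set_encode_empty finite.emptyI)

lemma tracks_mark [simp]: "finite S \<Longrightarrow> tracks (mark S) = S"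
  using set_encode_pos[of S] by (cases "S = {}") (auto simp: mark_def)

lemma is_bit_mark [simp]: "finite S \<Longrightarrow> \<not> is_bit (mark S)"
  using set_encode_pos[of S] by (auto simp: mark_def)

lemma mark_eq_Blank [simp]: "mark S = Blank \<longleftrightarrow> S = {}"
  by (simp add: mark_def)

text \<open>Every transition moves the head, so a change of control at the home cell
  is a step to the left (phase \<open>Back\<close>) followed by the return.\<close>

fun trans :: "nat \<Rightarrow> bool \<Rightarrow> phase \<times> cmd list \<Rightarrow> sym \<Rightarrow> (phase \<times> cmd list) \<times> sym \<times> move" where
  "trans N ch (Forth, k) a = (if is_bit a then ((Forth, k), a, MoveR) else ((Back, k), a, MoveL))"
| "trans N ch (Back, k) a =
     (if a \<noteq> Blank \<and> \<not> is_bit a then ((Back, k), a, MoveL) else ((Home, k), a, MoveR))"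
| "trans N ch (Home, Inc i # k) a =
     (if i \<in> tracks a then ((Home, Inc i # k), a, MoveR)
      else ((Back, k), mark (insert i (tracks a) \<inter> {..<N}), MoveL))"
| "trans N ch (Home, Dec i # k) a =
     (if i \<in> tracks a then ((Home, Dec i # k), a, MoveR) else ((Aux, Dec i # k), a, MoveL))"
| "trans N ch (Aux, Dec i # k) a =
     (if i \<in> tracks a then ((Back, k), mark ((tracks a - {i}) \<inter> {..<N}), MoveL)
      else ((Home, k), a, MoveR))"
| "trans N ch (Home, Toss i # k) a = ((Back, if ch then Inc i # k else k), a, MoveL)"
| "trans N ch (Home, Push b # k) a = ((Aux, Push b # k), a, MoveL)"
| "trans N ch (Aux, Push b # k) a =
     (if is_bit a then ((Aux, Push b # k), a, MoveL) else ((Forth, k), bsym b, MoveR))"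
| "trans N ch (Home, Pop i # k) a = ((Aux, Pop i # k), a, MoveL)"
| "trans N ch (Aux, Pop i # k) a =
     (if is_bit a then ((Aux, Pop i # k), a, MoveL) else ((Aux2, Pop i # k), a, MoveR))"
| "trans N ch (Aux2, Pop i # k) a =
     (if is_bit a then ((Forth, if a = bsym True then Inc i # k else k), Blank, MoveR)
      else ((Back, k), a, MoveL))"
| "trans N ch (Home, Seq c d # k) a = ((Back, c # d # k), a, MoveL)"
| "trans N ch (Home, Cond i c d # k) a = ((Back, if i \<in> tracks a then c # k else d # k), a, MoveL)"
| "trans N ch (Home, While i c # k) a =
     ((Back, if i \<in> tracks a then c # While i c # k else k), a, MoveL)"
| "trans N ch (_, k) a = ((Home, k), a, MoveR)"

text \<open>The command lists that occur while \<open>c\<close> is executed in front of \<open>k\<close>.\<close>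

primrec conts :: "cmd \<Rightarrow> cmd list \<Rightarrow> cmd list set" where
  "conts (Inc i) k = {Inc i # k}"
| "conts (Dec i) k = {Dec i # k}"
| "conts (Toss i) k = {Toss i # k, Inc i # k}"
| "conts (Push b) k = {Push b # k}"
| "conts (Pop i) k = {Pop i # k, Inc i # k}"
| "conts (Seq c d) k = insert (Seq c d # k) (conts c (d # k) \<union> conts d k)"
| "conts (Cond i c d) k = insert (Cond i c d # k) (conts c k \<union> conts d k)"
| "conts (While i c) k = insert (While i c # k) (conts c (While i c # k))"

lemma finite_conts: "finite (conts c k)"
  by (induction c arbitrary: k) auto

lemma conts_self: "c # k \<in> conts c k"
  by (cases c) auto

text \<open>The lists in \<open>conts c k\<close> can be left only towards \<open>k\<close>. In a
  sequence the first half exits to \<open>d # k\<close>, which is where the second half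
  begins.\<close>

lemma trans_conts:
  "k' \<in> conts c k \<Longrightarrow> trans N ch (p, k') a = ((p', k''), b, m) \<Longrightarrow> k'' \<in> insert k (conts c k)"
proof (induction c arbitrary: k)
  case (Seq c d)
  from Seq.prems(1) consider "k' = Seq c d # k" | "k' \<in> conts c (d # k)" | "k' \<in> conts d k" by auto
  then show ?case
    using Seq.IH(1)[of "d # k"] Seq.IH(2)[of k] Seq.prems(2) conts_self[of c "d # k"] conts_self[of d k]
    by cases (cases p; auto split: if_splits)+
next
  case (Cond i c d)
  from Cond.prems(1) consider "k' = Cond i c d # k" | "k' \<in> conts c k" | "k' \<in> conts d k" by auto
  then show ?case
    using Cond.IH(1)[of k] Cond.IH(2)[of k] Cond.prems(2) conts_self[of c k] conts_self[of d k]
    by cases (cases p; auto split: if_splits)+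
next
  case (While i c)
  from While.prems(1) consider "k' = While i c # k" | "k' \<in> conts c (While i c # k)" by auto
  then show ?case
    using While.IH(1)[of "While i c # k"] While.prems(2) conts_self[of c "While i c # k"]
    by cases (cases p; auto split: if_splits)+
qed (cases p; auto split: if_splits)+

text \<open>The bits and the codes of subsets of \<open>{..<N}\<close>. Since \<open>trans\<close>
  intersects each set that it writes with \<open>{..<N}\<close>, this alphabet is closed whatever
  symbol is scanned.\<close>

definition symbols :: "nat \<Rightarrow> nat set" where
  "symbols N = {0, 1} \<union> (\<lambda>S. Suc (set_encode S)) ` Pow {..<N}"

definition mstates :: "cmd \<Rightarrow> (phase \<times> cmd list) set" where
  "mstates c = UNIV \<times> insert [] (conts c [])"

definition enc_trans :: "nat \<Rightarrow> bool \<Rightarrow> nat \<Rightarrow> sym \<Rightarrow> nat \<times> sym \<times> move" where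
  "enc_trans N ch q a = map_prod to_nat id (trans N ch (from_nat q) a)"

text \<open>The start phase is \<open>Forth\<close>, because the head initially scans the first
  input symbol and has yet to reach the home cell.\<close>

definition machine :: "nat \<Rightarrow> cmd \<Rightarrow> ptm" where
  "machine N c = \<lparr>alphabet = symbols N, states = to_nat ` mstates c,
     init_state = to_nat (Forth, [c]), final_states = {to_nat (Home, [] :: cmd list)},
     delta0 = enc_trans N False, delta1 = enc_trans N True\<rparr>"

lemma UNIV_phase: "UNIV = {Home, Aux, Aux2, Back, Forth}"
  using phase.exhaust by auto

lemma mark_in_symbols: "mark (S \<inter> {..<N}) \<in> insert Blank (Sy ` symbols N)"
  by (auto simp: mark_def symbols_def)

lemma trans_symbols:
  assumes "a \<in> insert Blank (Sy ` symbols N)" "trans N ch s a = (s', b, m)"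
  shows "b \<in> insert Blank (Sy ` symbols N)"
proof -
  have "b \<in> {a, Blank, bsym True, bsym False} \<union> (\<lambda>S. mark (S \<inter> {..<N})) ` UNIV"
    using assms(2) by (cases "(N, ch, s, a)" rule: trans.cases) (auto split: if_splits)
  moreover have "{a, Blank, bsym True, bsym False} \<subseteq> insert Blank (Sy ` symbols N)"
    using assms(1) by (auto simp: bsym_def symbols_def)
  moreover have "(\<lambda>S. mark (S \<inter> {..<N})) ` UNIV \<subseteq> insert Blank (Sy ` symbols N)"
    using mark_in_symbols by (intro image_subsetI)
  ultimately show ?thesis by (meson Un_iff subsetD)
qed

lemma wf_machine: "wf_ptm (machine N c)"
proof -
  have "finite (mstates c)"
    by (simp add: mstates_def finite_conts UNIV_phase)
  moreover have "(\<lambda>(q', b, d). q' \<in> to_nat ` mstates c \<and> b \<in> insert Blank (Sy ` symbols N))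
      (enc_trans N ch q a)"
    if q: "q \<in> to_nat ` mstates c" and a: "a \<in> insert Blank (Sy ` symbols N)" for q a ch
  proof -
    from q obtain s where "s \<in> mstates c" "q = to_nat s" by (elim imageE)
    then obtain p :: phase and k :: "cmd list" where s: "q = to_nat (p, k)" "k \<in> insert [] (conts c [])"
      by (cases s) (auto simp: mstates_def)
    obtain p' k' b m where t: "trans N ch (p, k) a = ((p', k'), b, m)"
      by (cases "trans N ch (p, k) a") auto
    have "k' \<in> insert [] (conts c [])"
    proof (cases "k = []")
      case True
      then show ?thesis using t by (cases p) (auto split: if_splits)
    next
      case False
      then show ?thesis using s t trans_conts[of k c "[]"] by auto
    qed
    then show ?thesis
      using trans_symbols[OF a t] s t by (auto simp: enc_trans_def mstates_def)
  qed
  ultimately show ?thesis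
    by (auto simp: wf_ptm_def machine_def tape_syms_def symbols_def mstates_def conts_self)
qed

subsection \<open>Walks of the head\<close>

lemma step_machine:
  "step (machine N c) ch (conf L g q) = apply_trans (enc_trans N ch q (g 0)) (conf L g q)"
  by (simp add: step_def machine_def conf_def)

lemma is_final_machine: "is_final (machine N c) (conf L g (to_nat (p, k :: cmd list))) \<longleftrightarrow> p = Home \<and> k = []"
  by (auto simp: is_final_def machine_def conf_def)

abbreviation mconf :: "sym list \<Rightarrow> (nat \<Rightarrow> sym) \<Rightarrow> phase \<times> cmd list \<Rightarrow> config" where
  "mconf L g s \<equiv> conf L g (to_nat s)"

lemma step_R:
  assumes "trans N ch s (g 0) = (s', b, MoveR)" "eventually_blank g" "b \<noteq> Blank \<or> L \<noteq> []"
  shows "step (machine N c) ch (mconf L g s) = mconf (L @ [b]) (g \<circ> Suc) s'"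
  using assms by (auto simp: step_machine enc_trans_def apply_MoveR)

text \<open>A blank left behind at the far left disappears from the canonical form. This is how
  \<open>Pop\<close> shortens the stack, and how the head returns from the blank beyond its
  end.\<close>

lemma step_R_Nil:
  assumes "trans N ch s (g 0) = (s', Blank, MoveR)" "eventually_blank g"
  shows "step (machine N c) ch (mconf [] g s) = mconf [] (g \<circ> Suc) s'"
  using assms by (auto simp: step_machine enc_trans_def apply_MoveR)

text \<open>The configuration reached by a left move out of the leftmost cell of \<open>g\<close>;
  the left part of the tape is blank beyond \<open>L\<close>.\<close>

definition left :: "sym list \<Rightarrow> (nat \<Rightarrow> sym) \<Rightarrow> phase \<times> cmd list \<Rightarrow> config" where
  "left L g s = (if L = [] then mconf [] (scons Blank g) s else mconf (butlast L) (scons (last L) g) s)"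

lemma left_Nil [simp]: "left [] g s = mconf [] (scons Blank g) s"
  by (simp add: left_def)

lemma left_snoc [simp]: "left (L @ [x]) g s = mconf L (scons x g) s"
  by (simp add: left_def)

lemma step_L:
  assumes "trans N ch s (g 0) = (s', b, MoveL)" "eventually_blank g"
  shows "step (machine N c) ch (mconf L g s) = left L (scons b (g \<circ> Suc)) s'"
  using assms by (cases L rule: rev_cases)
    (auto simp: step_machine enc_trans_def apply_MoveL_Nil apply_MoveL_snoc)

lemma dstep_R:
  assumes "\<And>ch. trans N ch s (g 0) = (s', b, MoveR)" "eventually_blank g" "b \<noteq> Blank \<or> L \<noteq> []"
    "s \<noteq> (Home, [])"
  shows "dstep (machine N c) (mconf L g s) (mconf (L @ [b]) (g \<circ> Suc) s')"
  using assms by (cases s) (auto simp: dstep_def is_final_machine step_R)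

lemma dstep_R_Nil:
  assumes "\<And>ch. trans N ch s (g 0) = (s', Blank, MoveR)" "eventually_blank g" "s \<noteq> (Home, [])"
  shows "dstep (machine N c) (mconf [] g s) (mconf [] (g \<circ> Suc) s')"
  using assms by (cases s) (auto simp: dstep_def is_final_machine step_R_Nil)

lemma dstep_L:
  assumes "\<And>ch. trans N ch s (g 0) = (s', b, MoveL)" "eventually_blank g" "s \<noteq> (Home, [])"
  shows "dstep (machine N c) (mconf L g s) (left L (scons b (g \<circ> Suc)) s')"
  using assms by (cases s) (auto simp: dstep_def is_final_machine step_L)

lemma dstep_L_same:
  assumes "\<And>ch. trans N ch s (g 0) = (s', g 0, MoveL)" "eventually_blank g" "s \<noteq> (Home, [])"
  shows "dstep (machine N c) (mconf L g s) (left L g s')"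
  using dstep_L[OF assms] by (simp add: scons_0_Suc)

text \<open>The head at distance \<open>p\<close> to the right of the home cell, with the stack \<open>st\<close> to its left.\<close>

definition head_at :: "bool list \<Rightarrow> (nat \<Rightarrow> sym) \<Rightarrow> nat \<Rightarrow> phase \<times> cmd list \<Rightarrow> config" where
  "head_at st g p s = mconf (map bsym st @ map g [0..<p]) (\<lambda>j. g (p + j)) s"

definition left_at :: "bool list \<Rightarrow> (nat \<Rightarrow> sym) \<Rightarrow> nat \<Rightarrow> phase \<times> cmd list \<Rightarrow> config" where
  "left_at st g p s = left (map bsym st @ map g [0..<p]) (\<lambda>j. g (p + j)) s"

lemma left_at_0: "left_at st g 0 s = left (map bsym st) g s"
  by (simp add: left_at_def)

lemma left_at_Suc: "left_at st g (Suc p) s = head_at st g p s"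
proof -
  have "scons (g p) (\<lambda>j. g (Suc p + j)) = (\<lambda>j. g (p + j))"
    by (rule ext) (auto split: nat.split)
  then show ?thesis
    by (simp add: left_at_def head_at_def append_assoc[symmetric] del: append_assoc)
qed

lemma eventually_blank_shift [simp]: "eventually_blank g \<Longrightarrow> eventually_blank (\<lambda>j. g (p + j))"
  unfolding eventually_blank_def by (metis le_add2 le_trans add.commute)

lemma eventually_blank_upd [simp]: "eventually_blank g \<Longrightarrow> eventually_blank (g(p := b))"
proof -
  assume "eventually_blank g"
  then obtain n where "\<forall>j\<ge>n. g j = Blank" by (auto simp: eventually_blank_def)
  then have "\<forall>j\<ge>max n (Suc p). (g(p := b)) j = Blank" by auto
  then show ?thesis unfolding eventually_blank_def by blast
qed

lemma at_write_left:
  assumes "\<And>ch. trans N ch s (g p) = (s', b, MoveL)" "eventually_blank g" "s \<noteq> (Home, [])"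
  shows "dstep (machine N c) (head_at st g p s) (left_at st (g(p := b)) p s')"
proof -
  have 1: "scons b ((\<lambda>j. g (p + j)) \<circ> Suc) = (\<lambda>j. (g(p := b)) (p + j))"
    by (rule ext) (auto split: nat.split)
  have 2: "map (g(p := b)) [0..<p] = map g [0..<p]" by simp
  have "dstep (machine N c) (head_at st g p s)
      (left (map bsym st @ map g [0..<p]) (scons b ((\<lambda>j. g (p + j)) \<circ> Suc)) s')"
    unfolding head_at_def using assms by (intro dstep_L) auto
  then show ?thesis unfolding left_at_def 1 2 .
qed

lemma at_move_left:
  assumes "\<And>ch. trans N ch s (g p) = (s', g p, MoveL)" "eventually_blank g" "s \<noteq> (Home, [])"
  shows "dstep (machine N c) (head_at st g p s) (left_at st g p s')"
  using at_write_left[OF assms] by simp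

lemma at_move_right:
  assumes "\<And>ch. trans N ch s (g p) = (s', g p, MoveR)" "eventually_blank g" "s \<noteq> (Home, [])"
    "g p \<noteq> Blank"
  shows "dstep (machine N c) (head_at st g p s) (head_at st g (Suc p) s')"
proof -
  have 1: "(\<lambda>j. g (p + j)) \<circ> Suc = (\<lambda>j. g (Suc p + j))" by (rule ext) simp
  have 2: "map bsym st @ map g [0..<Suc p] = (map bsym st @ map g [0..<p]) @ [g p]" by simp
  show ?thesis
    unfolding head_at_def 1[symmetric] 2 using assms by (intro dstep_R) auto
qed

text \<open>Left of the home cell lies the bottom bit of the stack, or a blank if the stack is
  empty. The assumption on \<open>s\<close> covers both without knowing which.\<close>

lemma left_home_right:
  assumes "\<And>ch a. \<not> (a \<noteq> Blank \<and> \<not> is_bit a) \<Longrightarrow> trans N ch s a = (s', a, MoveR)"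
    "eventually_blank g" "s \<noteq> (Home, [])"
  shows "dstep (machine N c) (left_at st g 0 s) (head_at st g 0 s')"
proof (cases st rule: rev_cases)
  case Nil
  then show ?thesis
    using dstep_R_Nil[of N s "scons Blank g" s'] assms by (simp add: left_at_0 head_at_def)
next
  case (snoc st' b)
  then show ?thesis
    using dstep_R[of N s "scons (bsym b) g" s' "bsym b"] assms by (simp add: left_at_0 head_at_def)
qed

text \<open>In \<open>left_at st g p\<close> the head scans cell \<open>p - 1\<close>, or the cell
  left of home if \<open>p = 0\<close>. Hence only the cells below \<open>p\<close> have to carry
  marks, and cell \<open>p\<close> may just have become blank.\<close>

lemma back_home:
  assumes "eventually_blank g" "\<And>q. q < p \<Longrightarrow> g q \<noteq> Blank \<and> \<not> is_bit (g q)"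
  shows "(dstep (machine N c))\<^sup>+\<^sup>+ (left_at st g p (Back, k)) (head_at st g 0 (Home, k))"
  using assms(2)
proof (induction p)
  case 0
  show ?case
    by (rule tranclp.r_into_trancl, rule left_home_right) (auto simp: assms(1))
next
  case (Suc p)
  have "dstep (machine N c) (left_at st g (Suc p) (Back, k)) (left_at st g p (Back, k))"
    unfolding left_at_Suc using Suc.prems[of p] by (intro at_move_left) (auto simp: assms(1))
  then show ?case
    by (rule tranclp_into_tranclp2) (use Suc in auto)
qed

lemma leave_home:
  assumes "\<And>ch. trans N ch (Home, k) (g 0) = ((Back, k'), g 0, MoveL)" "eventually_blank g" "k \<noteq> []"
  shows "(dstep (machine N c))\<^sup>+\<^sup>+ (head_at st g 0 (Home, k)) (head_at st g 0 (Home, k'))"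
proof -
  have "dstep (machine N c) (head_at st g 0 (Home, k)) (left_at st g 0 (Back, k'))"
    using assms by (intro at_move_left) auto
  then show ?thesis
    by (rule tranclp_into_tranclp2) (use back_home[OF assms(2), of 0] in auto)
qed

text \<open>The cells passed must not be blank: with an empty stack, a blank passed over would be
  dropped by the canonical form.\<close>

lemma right_walk:
  assumes "\<And>q ch. q < p \<Longrightarrow> trans N ch s (g q) = (s, g q, MoveR)" "\<And>q. q < p \<Longrightarrow> g q \<noteq> Blank"
    "eventually_blank g" "s \<noteq> (Home, [])"
  shows "(dstep (machine N c))\<^sup>*\<^sup>* (head_at st g 0 s) (head_at st g p s)"
  using assms(1,2)
proof (induction p)
  case (Suc p)
  have "dstep (machine N c) (head_at st g p s) (head_at st g (Suc p) s)"
    using Suc.prems assms(3,4) by (intro at_move_right) auto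
  moreover have "(dstep (machine N c))\<^sup>*\<^sup>* (head_at st g 0 s) (head_at st g p s)"
    using Suc.prems by (intro Suc.IH) auto
  ultimately show ?case by (rule rtranclp.rtrancl_into_rtrancl[rotated])
qed simp

text \<open>The head inside the stack \<open>st1 @ st2\<close>, scanning the first symbol of \<open>st2\<close>
  (or the home cell if \<open>st2\<close> is empty).\<close>

definition inside :: "bool list \<Rightarrow> bool list \<Rightarrow> (nat \<Rightarrow> sym) \<Rightarrow> phase \<times> cmd list \<Rightarrow> config" where
  "inside st1 st2 g s = mconf (map bsym st1) (sapp (map bsym st2) g) s"

lemma inside_home: "inside st [] g s = head_at st g 0 s"
  by (simp add: inside_def head_at_def)

lemma stack_left_walk:
  assumes "\<And>ch b. trans N ch s (bsym b) = (s, bsym b, MoveL)" "eventually_blank g" "s \<noteq> (Home, [])"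
  shows "(dstep (machine N c))\<^sup>*\<^sup>* (left (map bsym st1) (sapp (map bsym st2) g) s)
    (left [] (sapp (map bsym (st1 @ st2)) g) s)"
proof (induction st1 arbitrary: st2 rule: rev_induct)
  case (snoc b st1)
  have "dstep (machine N c) (left (map bsym (st1 @ [b])) (sapp (map bsym st2) g) s)
      (left (map bsym st1) (sapp (map bsym (b # st2)) g) s)"
    using assms dstep_L_same[of N s "scons (bsym b) (sapp (map bsym st2) g)" s] by simp
  then show ?case
    by (rule converse_rtranclp_into_rtranclp) (use snoc[of "b # st2"] in simp)
qed simp

text \<open>The first symbol that is not a bit belongs to the home cell, which holds a mark or a
  blank.\<close>

lemma forth_home:
  assumes "eventually_blank g" "\<not> is_bit (g 0)"
  shows "(dstep (machine N c))\<^sup>*\<^sup>* (inside st1 st2 g (Forth, k)) (head_at (st1 @ st2) g 0 (Home, k))"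
proof (induction st2 arbitrary: st1)
  case Nil
  have "dstep (machine N c) (head_at st1 g 0 (Forth, k)) (left_at st1 g 0 (Back, k))"
    using assms by (intro at_move_left) auto
  then have "(dstep (machine N c))\<^sup>*\<^sup>* (head_at st1 g 0 (Forth, k)) (head_at st1 g 0 (Home, k))"
    by (rule converse_rtranclp_into_rtranclp)
      (use back_home[OF assms(1), of 0] in \<open>auto intro: tranclp_into_rtranclp\<close>)
  then show ?case by (simp add: inside_home)
next
  case (Cons b st2)
  have "dstep (machine N c) (inside st1 (b # st2) g (Forth, k)) (inside (st1 @ [b]) st2 g (Forth, k))"
    using assms dstep_R[of N "(Forth, k)" "scons (bsym b) (sapp (map bsym st2) g)" "(Forth, k)" "bsym b"
      "map bsym st1" c]
    by (simp add: inside_def)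
  then show ?case
    by (rule converse_rtranclp_into_rtranclp) (use Cons[of "st1 @ [b]"] in simp)
qed

subsection \<open>The machine executes its program\<close>

text \<open>Track \<open>i\<close> is marked on the cells \<open>p < \<sigma> i\<close>.  A cell that carries a mark is neither a bit
  nor blank, which makes both ends of the counter region recognizable.\<close>

definition tape :: "nat \<Rightarrow> (nat \<Rightarrow> nat) \<Rightarrow> nat \<Rightarrow> sym" where
  "tape N \<sigma> p = mark {i. i < N \<and> p < \<sigma> i}"

fun home :: "nat \<Rightarrow> cmd list \<Rightarrow> state \<Rightarrow> config" where
  "home N k (st, \<sigma>) = head_at st (tape N \<sigma>) 0 (Home, k)"

lemma tracks_tape [simp]: "tracks (tape N \<sigma> p) = {i. i < N \<and> p < \<sigma> i}"
  by (simp add: tape_def)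

lemma is_bit_tape [simp]: "\<not> is_bit (tape N \<sigma> p)"
  by (simp add: tape_def)

lemma tape_eq_Blank [simp]: "tape N \<sigma> p = Blank \<longleftrightarrow> (\<forall>i<N. \<sigma> i \<le> p)"
  by (auto simp: tape_def)

lemma eventually_blank_tape [simp]: "eventually_blank (tape N \<sigma>)"
proof -
  have "\<forall>j\<ge>\<Sum>i<N. \<sigma> i. tape N \<sigma> j = Blank"
    by (auto intro: order_trans[OF member_le_sum])
  then show ?thesis unfolding eventually_blank_def by blast
qed

lemma tape_Inc:
  assumes "i < N"
  shows "(tape N \<sigma>)(\<sigma> i := mark (insert i (tracks (tape N \<sigma> (\<sigma> i))) \<inter> {..<N})) =
    tape N (\<sigma>(i := Suc (\<sigma> i)))"
proof (rule ext)
  fix p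
  show "((tape N \<sigma>)(\<sigma> i := mark (insert i (tracks (tape N \<sigma> (\<sigma> i))) \<inter> {..<N}))) p =
      tape N (\<sigma>(i := Suc (\<sigma> i))) p"
  proof (cases "p = \<sigma> i")
    case True
    have "insert i {j. j < N \<and> p < \<sigma> j} \<inter> {..<N} = {j. j < N \<and> p < (\<sigma>(i := Suc (\<sigma> i))) j}"
      using True assms by auto
    with True show ?thesis by (simp only: tracks_tape fun_upd_same) (simp add: tape_def)
  next
    case False
    then have "{j. j < N \<and> p < \<sigma> j} = {j. j < N \<and> p < (\<sigma>(i := Suc (\<sigma> i))) j}"
      by auto
    with False show ?thesis by (simp add: tape_def del: fun_upd_apply) (simp add: tape_def)
  qed
qed

lemma tape_Dec:
  assumes "\<sigma> i = Suc q"
  shows "(tape N \<sigma>)(q := mark ((tracks (tape N \<sigma> q) - {i}) \<inter> {..<N})) = tape N (\<sigma>(i := q))"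
proof (rule ext)
  fix p
  show "((tape N \<sigma>)(q := mark ((tracks (tape N \<sigma> q) - {i}) \<inter> {..<N}))) p = tape N (\<sigma>(i := q)) p"
  proof (cases "p = q")
    case True
    have "({j. j < N \<and> p < \<sigma> j} - {i}) \<inter> {..<N} = {j. j < N \<and> p < (\<sigma>(i := q)) j}"
      using True assms by auto
    with True show ?thesis by (simp only: tracks_tape fun_upd_same) (simp add: tape_def)
  next
    case False
    then have "{j. j < N \<and> p < \<sigma> j} = {j. j < N \<and> p < (\<sigma>(i := q)) j}"
      using assms by auto
    with False show ?thesis by (simp add: tape_def del: fun_upd_apply) (simp add: tape_def)
  qed
qed

text \<open>Track \<open>i\<close> fills exactly the cells below \<open>\<sigma> i\<close>, and a
  cell on that track is never blank.\<close>

lemma find_end: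
  assumes "i < N" "\<And>ch a. i \<in> tracks a \<Longrightarrow> trans N ch s a = (s, a, MoveR)" "s \<noteq> (Home, [])"
  shows "(dstep (machine N c))\<^sup>*\<^sup>* (head_at st (tape N \<sigma>) 0 s) (head_at st (tape N \<sigma>) (\<sigma> i) s)"
  using assms by (intro right_walk) (auto simp: not_le)

lemma home_Inc:
  assumes "i < N"
  shows "(dstep (machine N c))\<^sup>+\<^sup>+ (home N (Inc i # k) (st, \<sigma>)) (home N k (st, \<sigma>(i := Suc (\<sigma> i))))"
proof -
  let ?g = "tape N (\<sigma>(i := Suc (\<sigma> i)))"
  have "(dstep (machine N c))\<^sup>*\<^sup>* (home N (Inc i # k) (st, \<sigma>))
      (head_at st (tape N \<sigma>) (\<sigma> i) (Home, Inc i # k))"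
    unfolding home.simps using assms by (intro find_end) auto
  also have "dstep (machine N c) (head_at st (tape N \<sigma>) (\<sigma> i) (Home, Inc i # k))
      (left_at st ?g (\<sigma> i) (Back, k))"
    unfolding tape_Inc[OF assms, symmetric] by (intro at_write_left) auto
  also have "(dstep (machine N c))\<^sup>+\<^sup>+ (left_at st ?g (\<sigma> i) (Back, k)) (head_at st ?g 0 (Home, k))"
    using assms by (intro back_home) (auto simp: not_le intro!: exI[of _ i])
  finally show ?thesis by simp
qed

lemma home_Dec:
  assumes "i < N"
  shows "(dstep (machine N c))\<^sup>+\<^sup>+ (home N (Dec i # k) (st, \<sigma>)) (home N k (st, \<sigma>(i := \<sigma> i - 1)))"
proof -
  have "(dstep (machine N c))\<^sup>*\<^sup>* (home N (Dec i # k) (st, \<sigma>))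
      (head_at st (tape N \<sigma>) (\<sigma> i) (Home, Dec i # k))"
    unfolding home.simps using assms by (intro find_end) auto
  also have "dstep (machine N c) (head_at st (tape N \<sigma>) (\<sigma> i) (Home, Dec i # k))
      (left_at st (tape N \<sigma>) (\<sigma> i) (Aux, Dec i # k))"
    by (intro at_move_left) auto
  also have "(dstep (machine N c))\<^sup>+\<^sup>+ (left_at st (tape N \<sigma>) (\<sigma> i) (Aux, Dec i # k))
      (home N k (st, \<sigma>(i := \<sigma> i - 1)))"
  proof (cases "\<sigma> i")
    \<comment> \<open>The head turned left on the home cell itself, so it now scans a stack bit or a
      blank. Neither carries a track, which tells the machine that the counter is zero and nothing
      is to be erased.\<close>
    case 0
    have no_track: "i \<notin> tracks a" if "\<not> (a \<noteq> Blank \<and> \<not> is_bit a)" for a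
      using that by (cases a) auto
    have "dstep (machine N c) (left_at st (tape N \<sigma>) 0 (Aux, Dec i # k)) (home N k (st, \<sigma>))"
      unfolding home.simps using no_track by (intro left_home_right) auto
    moreover have "\<sigma>(i := \<sigma> i - 1) = \<sigma>" using 0 by (auto simp: fun_eq_iff)
    ultimately show ?thesis using 0 by (simp add: tranclp.r_into_trancl)
  next
    case (Suc q)
    let ?g = "tape N (\<sigma>(i := q))"
    have "dstep (machine N c) (left_at st (tape N \<sigma>) (Suc q) (Aux, Dec i # k))
        (left_at st ?g q (Back, k))"
      unfolding left_at_Suc tape_Dec[where \<sigma> = \<sigma> and i = i, OF Suc, symmetric] using Suc assms
      by (intro at_write_left) auto
    also have "(dstep (machine N c))\<^sup>+\<^sup>+ (left_at st ?g q (Back, k)) (head_at st ?g 0 (Home, k))"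
      using assms by (intro back_home) (auto simp: not_le intro!: exI[of _ i])
    finally show ?thesis using Suc by simp
  qed
  finally show ?thesis .
qed

text \<open>The walk ends on the blank beyond the top of the stack, where \<open>Push\<close> writes
  its bit and from which \<open>Pop\<close> steps right onto the top, or onto the home cell if the
  stack is empty.\<close>

lemma enter_stack:
  assumes "\<And>ch. trans N ch (Home, k) (tape N \<sigma> 0) = (s, tape N \<sigma> 0, MoveL)" "k \<noteq> []"
    "\<And>ch b. trans N ch s (bsym b) = (s, bsym b, MoveL)" "s \<noteq> (Home, [])"
  shows "(dstep (machine N c))\<^sup>+\<^sup>+ (home N k (st, \<sigma>))
    (mconf [] (scons Blank (sapp (map bsym st) (tape N \<sigma>))) s)"
proof -
  have "dstep (machine N c) (home N k (st, \<sigma>)) (left_at st (tape N \<sigma>) 0 s)"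
    unfolding home.simps using assms by (intro at_move_left) auto
  moreover have "(dstep (machine N c))\<^sup>*\<^sup>* (left_at st (tape N \<sigma>) 0 s)
      (left [] (sapp (map bsym st) (tape N \<sigma>)) s)"
    unfolding left_at_0 using stack_left_walk[of N s "tape N \<sigma>" c st "[]"] assms by simp
  ultimately show ?thesis using rtranclp_into_tranclp2 by fastforce
qed

lemma home_Push:
  "(dstep (machine N c))\<^sup>+\<^sup>+ (home N (Push b # k) (st, \<sigma>)) (home N k (b # st, \<sigma>))"
proof -
  have "(dstep (machine N c))\<^sup>+\<^sup>+ (home N (Push b # k) (st, \<sigma>))
      (mconf [] (scons Blank (sapp (map bsym st) (tape N \<sigma>))) (Aux, Push b # k))"
    by (intro enter_stack) auto
  also have "dstep (machine N c) \<dots> (inside [b] st (tape N \<sigma>) (Forth, k))"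
    using dstep_R[of N "(Aux, Push b # k)" "scons Blank (sapp (map bsym st) (tape N \<sigma>))" "(Forth, k)"
      "bsym b" "[]" c] by (simp add: inside_def)
  also have "(dstep (machine N c))\<^sup>*\<^sup>* \<dots> (home N k (b # st, \<sigma>))"
    using forth_home[of "tape N \<sigma>" N c "[b]" st k] by simp
  finally show ?thesis .
qed

text \<open>A popped 1 is not added on the spot; control passes to \<open>Inc i\<close>. This is why
  \<open>conts (Pop i) k\<close> contains \<open>Inc i # k\<close>.\<close>

lemma home_Pop:
  "(dstep (machine N c))\<^sup>+\<^sup>+ (home N (Pop i # k) (st, \<sigma>))
    (home N (if st \<noteq> [] \<and> hd st then Inc i # k else k) (tl st, \<sigma>))"
proof -
  have "(dstep (machine N c))\<^sup>+\<^sup>+ (home N (Pop i # k) (st, \<sigma>))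
      (mconf [] (scons Blank (sapp (map bsym st) (tape N \<sigma>))) (Aux, Pop i # k))"
    by (intro enter_stack) auto
  also have "dstep (machine N c) \<dots> (inside [] st (tape N \<sigma>) (Aux2, Pop i # k))"
    using dstep_R_Nil[of N "(Aux, Pop i # k)" "scons Blank (sapp (map bsym st) (tape N \<sigma>))"
      "(Aux2, Pop i # k)" c] by (simp add: inside_def)
  also have "(dstep (machine N c))\<^sup>*\<^sup>* \<dots>
      (home N (if st \<noteq> [] \<and> hd st then Inc i # k else k) (tl st, \<sigma>))"
  proof (cases st)
    case Nil
    have "dstep (machine N c) (head_at [] (tape N \<sigma>) 0 (Aux2, Pop i # k))
        (left_at [] (tape N \<sigma>) 0 (Back, k))"
      by (intro at_move_left) auto
    also have "(dstep (machine N c))\<^sup>+\<^sup>+ \<dots> (head_at [] (tape N \<sigma>) 0 (Home, k))"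
      by (intro back_home) auto
    finally show ?thesis using Nil by (simp add: inside_home tranclp_into_rtranclp)
  next
    case (Cons b st')
    have "dstep (machine N c) (inside [] st (tape N \<sigma>) (Aux2, Pop i # k))
       (inside [] st' (tape N \<sigma>) (Forth, if b then Inc i # k else k))"
      using dstep_R_Nil[of N "(Aux2, Pop i # k)" "scons (bsym b) (sapp (map bsym st') (tape N \<sigma>))"
        "(Forth, if b then Inc i # k else k)" c] Cons by (simp add: inside_def)
    also have "(dstep (machine N c))\<^sup>*\<^sup>* \<dots>
        (head_at ([] @ st') (tape N \<sigma>) 0 (Home, if b then Inc i # k else k))"
      by (intro forth_home) auto
    finally show ?thesis using Cons by (simp add: tranclp_into_rtranclp)
  qed
  finally show ?thesis .
qed

lemma home_Seq: "(dstep (machine N c))\<^sup>+\<^sup>+ (home N (Seq a b # k) s) (home N (a # b # k) s)"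
  by (cases s) (auto intro!: leave_home)

lemma home_Cond:
  "i < N \<Longrightarrow> (dstep (machine N c))\<^sup>+\<^sup>+ (home N (Cond i a b # k) s)
    (home N (if snd s i = 0 then b # k else a # k) s)"
  by (cases s) (auto intro!: leave_home)

lemma home_While:
  "i < N \<Longrightarrow> (dstep (machine N c))\<^sup>+\<^sup>+ (home N (While i a # k) s)
    (home N (if snd s i = 0 then k else a # While i a # k) s)"
  by (cases s) (auto intro!: leave_home)

text \<open>The choice only selects the list of pending commands; the increment is left to an
  ordinary \<open>Inc\<close>. After the toss both branches continue deterministically.\<close>

lemma step_Toss:
  assumes "i < N"
  obtains c1 c2 where
    "\<not> is_final (machine N c) (home N (Toss i # k) s)"
    "step (machine N c) True (home N (Toss i # k) s) = c1"
    "step (machine N c) False (home N (Toss i # k) s) = c2"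
    "(dstep (machine N c))\<^sup>*\<^sup>* c1 (home N (Inc i # k) s)"
    "(dstep (machine N c))\<^sup>*\<^sup>* c2 (home N k s)"
proof -
  obtain st \<sigma> where s: "s = (st, \<sigma>)" by (cases s)
  let ?g = "tape N \<sigma>"
  have h: "home N k' s = mconf (map bsym st) ?g (Home, k')" for k'
    by (simp add: s head_at_def)
  have 1: "step (machine N c) ch (home N (Toss i # k) s) =
      left_at st ?g 0 (Back, if ch then Inc i # k else k)" for ch
    unfolding h left_at_0 by (subst step_L) (auto simp: scons_0_Suc)
  have 2: "(dstep (machine N c))\<^sup>*\<^sup>* (left_at st ?g 0 (Back, k')) (home N k' s)" for k'
    using back_home[of ?g 0 N c st k'] by (simp add: s tranclp_into_rtranclp)
  show thesis
    by (rule that[of "left_at st ?g 0 (Back, Inc i # k)" "left_at st ?g 0 (Back, k)"])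
      (auto simp: 1 2, simp add: h is_final_machine)
qed

section \<open>Output probability equals pre-expectation\<close>

text \<open>The induction is on the budget, for all command lists at once: unrolling a loop makes
  the list longer, but always at the price of a machine step.\<close>

lemma acc_le_wps:
  assumes "\<And>c. c \<in> set k \<Longrightarrow> regs c \<subseteq> {..<N}"
  shows "acc (machine N p) w n (home N k s) \<le> wps k (\<lambda>s. val (machine N p) w (home N [] s)) s"
  using assms
proof (induction n arbitrary: k s)
  case (Suc n)
  let ?M = "machine N p" and ?F = "\<lambda>s. val (machine N p) w (home N [] s)"
  \<comment> \<open>For each command other than \<open>Toss\<close> it remains to name the next home
    configuration and to check that the pre-expectation is unchanged.\<close>
  have go: "acc ?M w (Suc n) (home N k s) \<le> wps k ?F s"
    if "(dstep ?M)\<^sup>+\<^sup>+ (home N k s) (home N k' s')" "wps k' ?F s' = wps k ?F s"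
      "\<And>c. c \<in> set k' \<Longrightarrow> regs c \<subseteq> {..<N}" for k' s'
    using order_trans[OF acc_dsteps1[OF that(1), of w n] Suc.IH[OF that(3)]] that(2) by simp
  obtain st \<sigma> where s: "s = (st, \<sigma>)" by (cases s)
  show ?case
  proof (cases k)
    case Nil
    then show ?thesis by (simp add: acc_le_val del: acc.simps)
  next
    case (Cons c k')
    have k': "\<And>c. c \<in> set k' \<Longrightarrow> regs c \<subseteq> {..<N}" and c: "regs c \<subseteq> {..<N}"
      using Suc.prems Cons by auto
    show ?thesis
    proof (cases c)
      case (Inc i)
      show ?thesis
        by (rule go) (use c k' in \<open>auto simp: Cons s Inc simp del: home.simps intro!: home_Inc\<close>)
    next
      case (Dec i)
      with c have i: "i < N" by simp
      show ?thesis
      proof (rule go)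
        show "(dstep ?M)\<^sup>+\<^sup>+ (home N k s) (home N k' (st, \<sigma>(i := \<sigma> i - 1)))"
          unfolding Cons Dec s by (rule home_Dec[OF i])
      qed (use k' in \<open>auto simp: Cons s Dec\<close>)
    next
      case (Toss i)
      with c have i: "i < N" by simp
      obtain c1 c2 where st: "\<not> is_final ?M (home N (Toss i # k') s)"
          "step ?M True (home N (Toss i # k') s) = c1" "step ?M False (home N (Toss i # k') s) = c2"
          "(dstep ?M)\<^sup>*\<^sup>* c1 (home N (Inc i # k') s)" "(dstep ?M)\<^sup>*\<^sup>* c2 (home N k' s)"
        by (rule step_Toss[OF i])
      have "acc ?M w (Suc n) (home N k s) = (acc ?M w n c1 + acc ?M w n c2) / 2"
        using st Cons Toss by simp
      also have "\<dots> \<le> (wps (Inc i # k') ?F s + wps k' ?F s) / 2"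
      proof (intro ennreal_half_mono add_mono)
        show "acc ?M w n c1 \<le> wps (Inc i # k') ?F s"
          by (rule order_trans[OF acc_dsteps[OF st(4)] Suc.IH]) (use i k' in auto)
        show "acc ?M w n c2 \<le> wps k' ?F s"
          by (rule order_trans[OF acc_dsteps[OF st(5)] Suc.IH]) (use k' in auto)
      qed
      finally show ?thesis by (simp add: Cons Toss s)
    next
      case (Push b)
      show ?thesis
      proof (rule go)
        show "(dstep ?M)\<^sup>+\<^sup>+ (home N k s) (home N k' (b # st, \<sigma>))"
          unfolding Cons Push s by (rule home_Push)
      qed (use c k' in \<open>auto simp: Cons s Push\<close>)
    next
      case (Pop i)
      show ?thesis
      proof (rule go)
        show "(dstep ?M)\<^sup>+\<^sup>+ (home N k s) (home N (if st \<noteq> [] \<and> hd st then Inc i # k' else k') (tl st, \<sigma>))"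
          unfolding Cons Pop s by (rule home_Pop)
      qed (use c k' in \<open>auto simp: Cons s Pop split: if_splits\<close>)
    next
      case (Seq a b)
      show ?thesis
      proof (rule go)
        show "(dstep ?M)\<^sup>+\<^sup>+ (home N k s) (home N (a # b # k') s)"
          unfolding Cons Seq s by (rule home_Seq)
      qed (use c k' in \<open>auto simp: Cons s Seq\<close>)
    next
      case (Cond i a b)
      with c have i: "i < N" by simp
      show ?thesis
      proof (rule go)
        show "(dstep ?M)\<^sup>+\<^sup>+ (home N k s) (home N (if snd s i = 0 then b # k' else a # k') s)"
          unfolding Cons Cond by (rule home_Cond[OF i])
      qed (use c k' in \<open>auto simp: Cons Cond split: if_splits\<close>)
    next
      case (While i a)
      with c have i: "i < N" by simp
      show ?thesis
      proof (rule go)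
        show "(dstep ?M)\<^sup>+\<^sup>+ (home N k s) (home N (if snd s i = 0 then k' else a # While i a # k') s)"
          unfolding Cons While by (rule home_While[OF i])
      qed (use c k' in \<open>auto simp: Cons While wp_While_unfold[of i a _ s] split: if_splits\<close>)
    qed
  qed
qed simp

text \<open>Structural induction, with the commands still pending absorbed into the expectation. For
  a loop, the induction hypothesis for the body makes the output probability a pre-fixed point,
  which bounds the least one.\<close>

lemma wp_le_val:
  "regs c \<subseteq> {..<N} \<Longrightarrow>
    wp c (\<lambda>s. val (machine N p) w (home N k s)) s \<le> val (machine N p) w (home N (c # k) s)"
proof (induction c arbitrary: k s)
  case (Seq a b)
  have "wp (Seq a b) (\<lambda>s. val (machine N p) w (home N k s)) s \<le>
      wp a (\<lambda>s. val (machine N p) w (home N (b # k) s)) s"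
    unfolding wp.simps using Seq by (intro le_funD[OF wp_mono] le_funI) auto
  also have "\<dots> \<le> val (machine N p) w (home N (a # b # k) s)"
    using Seq by auto
  finally show ?case by (simp add: val_dsteps[OF tranclp_into_rtranclp[OF home_Seq]])
next
  case (Cond i a b)
  then have "i < N" by simp
  then show ?case
    using Cond by (simp add: val_dsteps[OF tranclp_into_rtranclp[OF home_Cond]])
next
  case (While i a)
  then have i: "i < N" by simp
  have "wp (While i a) (\<lambda>s. val (machine N p) w (home N k s)) \<le>
      (\<lambda>s. val (machine N p) w (home N (While i a # k) s))"
    unfolding wp.simps
  proof (rule lfp_lowerbound, rule le_funI)
    fix s
    have eq: "val (machine N p) w (home N (While i a # k) s) =
        val (machine N p) w (home N (if snd s i = 0 then k else a # While i a # k) s)"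
      by (rule val_dsteps[OF tranclp_into_rtranclp[OF home_While[OF i]]])
    show "(if snd s i = 0 then val (machine N p) w (home N k s)
        else wp a (\<lambda>s. val (machine N p) w (home N (While i a # k) s)) s)
        \<le> val (machine N p) w (home N (While i a # k) s)"
      using While by (simp add: eq)
  qed
  then show ?case by (rule le_funD)
next
  case (Toss i)
  then have i: "i < N" by simp
  obtain st \<sigma> where s: "s = (st, \<sigma>)" by (cases s)
  obtain c1 c2 where st: "\<not> is_final (machine N p) (home N (Toss i # k) s)"
      "step (machine N p) True (home N (Toss i # k) s) = c1"
      "step (machine N p) False (home N (Toss i # k) s) = c2"
      "(dstep (machine N p))\<^sup>*\<^sup>* c1 (home N (Inc i # k) s)" "(dstep (machine N p))\<^sup>*\<^sup>* c2 (home N k s)"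
    by (rule step_Toss[OF i])
  have "val (machine N p) w (home N (Inc i # k) s) =
      val (machine N p) w (home N k (st, \<sigma>(i := Suc (\<sigma> i))))"
    unfolding s by (rule val_dsteps[OF tranclp_into_rtranclp[OF home_Inc[OF i]]])
  then show ?case
    using st by (simp add: val_step val_dsteps s del: home.simps)
next
  case (Inc i)
  then have "i < N" by simp
  then show ?case
    by (cases s) (simp add: val_dsteps[OF tranclp_into_rtranclp[OF home_Inc]] del: home.simps)
next
  case (Dec i)
  then have "i < N" by simp
  then show ?case
    by (cases s) (simp add: val_dsteps[OF tranclp_into_rtranclp[OF home_Dec]] del: home.simps)
next
  case (Push b)
  show ?case
    by (cases s) (simp add: val_dsteps[OF tranclp_into_rtranclp[OF home_Push]] del: home.simps)
next
  case (Pop i)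
  then have i: "i < N" by simp
  obtain st \<sigma> where s: "s = (st, \<sigma>)" by (cases s)
  show ?case
    unfolding s val_dsteps[OF tranclp_into_rtranclp[OF home_Pop]]
    using i by (simp add: val_dsteps[OF tranclp_into_rtranclp[OF home_Inc]] del: home.simps)
qed

lemma val_home:
  assumes "regs c \<subseteq> {..<N}"
  shows "val (machine N p) w (home N [c] s) = wp c (\<lambda>s. val (machine N p) w (home N [] s)) s"
proof (rule antisym)
  show "val (machine N p) w (home N [c] s) \<le> wp c (\<lambda>s. val (machine N p) w (home N [] s)) s"
    unfolding val_def[of _ _ "home N [c] s"]
    using acc_le_wps[of "[c]" N p w _ s] assms by (intro SUP_least) auto
  show "wp c (\<lambda>s. val (machine N p) w (home N [] s)) s \<le> val (machine N p) w (home N [c] s)"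
    by (rule wp_le_val[OF assms])
qed

text \<open>With all counters at zero the tape is blank from the home cell on, so the stack alone is
  the output.\<close>

lemma val_home_Nil:
  assumes "\<And>i. i < N \<Longrightarrow> \<sigma> i = 0"
  shows "val (machine N p) (map bsym out) (home N [] (st, \<sigma>)) = (if st = out then 1 else 0)"
proof -
  have "tape N \<sigma> = (\<lambda>_. Blank)" using assms by (auto simp: fun_eq_iff)
  then have h: "home N [] (st, \<sigma>) = (map bsym st, Blank, [], to_nat (Home, [] :: cmd list))"
    by (simp add: head_at_def conf_def comp_def)
  have "inj bsym" by (rule injI) simp
  then show ?thesis
    unfolding h by (subst val_final)
      (auto simp: is_final_def final_with_output_def machine_def inj_map_eq_map)
qed

text \<open>The initial configuration already is a stack over zero counters; a single
  \<open>Forth\<close> walk takes the head to the home cell.\<close>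

lemma val_initial:
  "val (machine N c) w (initial_config (machine N c) (map bsym st)) = val (machine N c) w (home N [c] (st, \<lambda>_. 0))"
proof -
  have t: "tape N (\<lambda>_. 0) = (\<lambda>_. Blank)" by (auto simp: fun_eq_iff)
  have ev: "eventually_blank (\<lambda>_. Blank)" by (simp add: eventually_blank_def)
  have nb: "Blank \<notin> set (map bsym xs)" for xs by auto
  have "initial_config (machine N c) (map bsym st) = inside [] st (tape N (\<lambda>_. 0)) (Forth, [c])"
    using trim_sapp[OF nb]
    by (cases st) (auto simp: initial_config_def inside_def conf_def machine_def t comp_def)
  then show ?thesis
    using forth_home[of "tape N (\<lambda>_. 0)" N c "[]" st "[c]"] by (simp add: val_dsteps)
qed

lemma IO_machine:
  assumes "regs c \<subseteq> {..<N}"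
  shows "ennreal (IO (machine N c) (map bsym st) w) =
    wp c (\<lambda>s. val (machine N c) w (home N [] s)) (st, \<lambda>_. 0)"
  by (simp only: ennreal_IO val_initial val_home[OF assms])

subsection \<open>Sums\<close>

abbreviation nsum :: "('a \<Rightarrow> ennreal) \<Rightarrow> 'a set \<Rightarrow> ennreal" where
  "nsum f A \<equiv> nn_integral (count_space A) f"

lemma nsum_swap:
  fixes A :: "'a::countable set"
  shows "(\<integral>\<^sup>+y. \<integral>\<^sup>+x. f x y \<partial>count_space A \<partial>count_space B) =
    (\<integral>\<^sup>+x. \<integral>\<^sup>+y. f x y \<partial>count_space B \<partial>count_space A)"
  by (rule nn_integral_count_space_nn_integral) auto

lemma nsum_cmult: "(\<integral>\<^sup>+x. c * f x \<partial>count_space A) = c * (\<integral>\<^sup>+x. f x \<partial>count_space A)" for c :: ennreal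
  by (rule nn_integral_cmult) simp

lemma nsum_multc: "(\<integral>\<^sup>+x. f x * c \<partial>count_space A) = (\<integral>\<^sup>+x. f x \<partial>count_space A) * c" for c :: ennreal
  by (rule nn_integral_multc) simp

lemma nsum_point:
  "(\<integral>\<^sup>+y. (if y = a then 1 else 0) * G y \<partial>count_space UNIV) = (G a :: ennreal)"
proof -
  have "(\<integral>\<^sup>+y. (if y = a then 1 else 0) * G y \<partial>count_space UNIV) =
      (\<Sum>y\<in>{a}. (if y = a then 1 else 0) * G y)"
    by (rule nn_integral_count_space') auto
  then show ?thesis by simp
qed

lemma nsum_lists_Suc:
  fixes h :: "'a::countable list \<Rightarrow> ennreal"
  shows "(\<integral>\<^sup>+zs. h zs \<partial>count_space {zs. length zs = Suc n}) =
    (\<integral>\<^sup>+z. \<integral>\<^sup>+zs. h (z # zs) \<partial>count_space {zs. length zs = n} \<partial>count_space UNIV)"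
proof -
  let ?L = "{zs :: 'a list. length zs = n}"
  have "bij_betw (\<lambda>(z, zs). z # zs) (UNIV \<times> ?L) {zs. length zs = Suc n}"
    by (rule bij_betwI[where g = "\<lambda>zs. (hd zs, tl zs)"]) (auto simp: length_Suc_conv)
  then have "(\<integral>\<^sup>+zs. h zs \<partial>count_space {zs. length zs = Suc n}) =
      (\<integral>\<^sup>+p. h (case p of (z, zs) \<Rightarrow> z # zs) \<partial>count_space (UNIV \<times> ?L))"
    by (rule nn_integral_bij_count_space[symmetric])
  also have "\<dots> = (\<integral>\<^sup>+p. h (case p of (z, zs) \<Rightarrow> z # zs) * indicator (UNIV \<times> ?L) p \<partial>count_space UNIV)"
    by (rule nn_integral_count_space_indicator) simp
  also have "\<dots> = (\<integral>\<^sup>+z. \<integral>\<^sup>+zs. h (z # zs) * indicator (UNIV \<times> ?L) (z, zs) \<partial>count_space UNIV \<partial>count_space UNIV)"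
    by (subst nn_integral_fst_count_space[symmetric]) simp
  also have "\<dots> = (\<integral>\<^sup>+z. \<integral>\<^sup>+zs. h (z # zs) * indicator ?L zs \<partial>count_space UNIV \<partial>count_space UNIV)"
    by (simp add: indicator_def)
  also have "\<dots> = (\<integral>\<^sup>+z. \<integral>\<^sup>+zs. h (z # zs) \<partial>count_space ?L \<partial>count_space UNIV)"
    by (simp add: nn_integral_count_space_indicator)
  finally show ?thesis .
qed

lemma nsum_split_0:
  fixes f :: "nat \<Rightarrow> ennreal"
  shows "(\<integral>\<^sup>+k. f k \<partial>count_space UNIV) = f 0 + (\<integral>\<^sup>+k. f k \<partial>count_space {0<..})"
proof -
  have "(\<integral>\<^sup>+k. f k \<partial>count_space UNIV) =
      (\<integral>\<^sup>+k. (if k = 0 then 1 else 0) * f k + f k * indicator {0<..} k \<partial>count_space UNIV)"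
    by (intro nn_integral_cong) (auto simp: indicator_def)
  also have "\<dots> = (\<integral>\<^sup>+k. (if k = 0 then 1 else 0) * f k \<partial>count_space UNIV) +
      (\<integral>\<^sup>+k. f k * indicator {0<..} k \<partial>count_space UNIV)"
    by (rule nn_integral_add) auto
  also have "\<dots> = f 0 + (\<integral>\<^sup>+k. f k \<partial>count_space {0<..})"
    by (simp only: nsum_point) (simp add: nn_integral_count_space_indicator)
  finally show ?thesis .
qed

lemma nsum_shift_Suc:
  fixes f :: "nat \<Rightarrow> ennreal"
  shows "(\<integral>\<^sup>+k. f k \<partial>count_space UNIV) = f 0 + (\<integral>\<^sup>+k. f (Suc k) \<partial>count_space UNIV)"
  using suminf_offset[of f 1] by (simp add: nn_integral_count_space_nat add.commute)

subsection \<open>Programs that ignore high registers\<close>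

definition indep :: "nat \<Rightarrow> (state \<Rightarrow> ennreal) \<Rightarrow> bool" where
  "indep b F \<longleftrightarrow> (\<forall>st \<sigma> \<sigma>'. (\<forall>j<b. \<sigma> j = \<sigma>' j) \<longrightarrow> F (st, \<sigma>) = F (st, \<sigma>'))"

text \<open>Needed because the specification of a program inside a loop applies only to
  expectations that ignore its scratch registers, such as that of the loop itself.\<close>

definition local_prog :: "nat \<Rightarrow> cmd \<Rightarrow> bool" where
  "local_prog b c \<longleftrightarrow> (\<forall>F. indep b F \<longrightarrow> indep b (wp c F))"

lemma indepI: "(\<And>st \<sigma> \<sigma>'. \<forall>j<b. \<sigma> j = \<sigma>' j \<Longrightarrow> F (st, \<sigma>) = F (st, \<sigma>')) \<Longrightarrow> indep b F"
  by (auto simp: indep_def)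

lemma indepD: "indep b F \<Longrightarrow> \<forall>j<b. \<sigma> j = \<sigma>' j \<Longrightarrow> F (st, \<sigma>) = F (st, \<sigma>')"
  by (auto simp: indep_def)

lemma indep_mono: "indep b F \<Longrightarrow> b \<le> b' \<Longrightarrow> indep b' F"
  by (auto simp: indep_def)

lemma indep_if:
  assumes "i < b" "indep b F" "indep b G"
  shows "indep b (\<lambda>s. if snd s i = 0 then F s else G s)"
proof (rule indepI)
  fix st \<sigma> \<sigma>' assume eq: "\<forall>j<b. \<sigma> j = (\<sigma>' j :: nat)"
  have "F (st, \<sigma>) = F (st, \<sigma>')" "G (st, \<sigma>) = G (st, \<sigma>')"
    by (rule indepD[OF assms(2) eq], rule indepD[OF assms(3) eq])
  then show "(if snd (st, \<sigma>) i = 0 then F (st, \<sigma>) else G (st, \<sigma>)) =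
      (if snd (st, \<sigma>') i = 0 then F (st, \<sigma>') else G (st, \<sigma>'))"
    using eq assms(1) by simp
qed

lemma local_Seq: "local_prog b c \<Longrightarrow> local_prog b d \<Longrightarrow> local_prog b (Seq c d)"
  by (simp add: local_prog_def)

text \<open>A least fixed point is reached from below by applying the body and taking suprema, and
  both operations preserve \<open>indep b\<close>.\<close>

lemma local_While:
  assumes "i < b" "local_prog b c"
  shows "local_prog b (While i c)"
  unfolding local_prog_def
proof (intro allI impI)
  fix F assume F: "indep b F"
  show "indep b (wp (While i c) F)"
    unfolding wp.simps
  proof (rule lfp_ordinal_induct[OF mono_while_body])
    fix W assume "indep b W"
    then have "indep b (wp c W)" using assms(2) by (simp add: local_prog_def)
    then show "indep b (\<lambda>s. if snd s i = 0 then F s else wp c W s)"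
      by (intro indep_if assms(1) F)
  next
    fix M assume M: "\<forall>W\<in>M. indep b W"
    show "indep b (Sup M)"
    proof (rule indepI)
      fix st \<sigma> \<sigma>' assume eq: "\<forall>j<b. \<sigma> j = (\<sigma>' j :: nat)"
      show "Sup M (st, \<sigma>) = Sup M (st, \<sigma>')"
        unfolding Sup_apply by (rule SUP_cong[OF refl]) (rule indepD[OF bspec[OF M] eq])
    qed
  qed
qed

lemma local_regs: "regs c \<subseteq> {..<b} \<Longrightarrow> local_prog b c"
proof (induction c)
  case (Seq c d)
  then show ?case by (auto intro: local_Seq)
next
  case (While i c)
  then show ?case by (auto intro: local_While)
next
  case (Cond i c d)
  then have i: "i < b" and "local_prog b c" "local_prog b d" by auto
  then have *: "indep b (wp c F)" "indep b (wp d F)" if "indep b F" for F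
    using that by (auto simp: local_prog_def)
  have "indep b (\<lambda>s. if snd s i = 0 then wp d F s else wp c F s)" if "indep b F" for F
    by (intro indep_if i * that)
  then show ?case by (simp add: local_prog_def)
next
  case (Toss i)
  have "indep b (wp (Toss i) F)" if F: "indep b F" for F
  proof (rule indepI)
    fix st \<sigma> \<sigma>' assume *: "\<forall>j<b. \<sigma> j = (\<sigma>' j :: nat)"
    then have "F (st, \<sigma>) = F (st, \<sigma>')" "F (st, \<sigma>(i := Suc (\<sigma> i))) = F (st, \<sigma>'(i := Suc (\<sigma>' i)))"
      using Toss by (auto intro!: indepD[OF F])
    then show "wp (Toss i) F (st, \<sigma>) = wp (Toss i) F (st, \<sigma>')" by simp
  qed
  then show ?case by (simp add: local_prog_def)
next
  case (Pop i)
  have "indep b (wp (Pop i) F)" if F: "indep b F" for F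
  proof (rule indepI)
    fix st \<sigma> \<sigma>' assume *: "\<forall>j<b. \<sigma> j = (\<sigma>' j :: nat)"
    then have "F (tl st, \<sigma>) = F (tl st, \<sigma>')"
      "F (tl st, \<sigma>(i := Suc (\<sigma> i))) = F (tl st, \<sigma>'(i := Suc (\<sigma>' i)))"
      using Pop by (auto intro!: indepD[OF F])
    then show "wp (Pop i) F (st, \<sigma>) = wp (Pop i) F (st, \<sigma>')" by (cases st) simp_all
  qed
  then show ?case by (simp add: local_prog_def)
next
  case (Inc i)
  then show ?case
    by (auto simp: local_prog_def intro!: indepI) (erule indepD, auto)
next
  case (Dec i)
  then show ?case
    by (auto simp: local_prog_def intro!: indepI) (erule indepD, auto)
next
  case (Push x)
  then show ?case
    by (auto simp: local_prog_def intro!: indepI) (erule indepD, auto)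
qed

subsection \<open>Register transfers\<close>

definition clear :: "nat \<Rightarrow> cmd" where
  "clear i = While i (Dec i)"

lemma regs_clear [simp]: "regs (clear i) = {i}"
  by (simp add: clear_def)

lemma wp_clear [simp]: "wp (clear i) F (st, \<sigma>) = F (st, \<sigma>(i := 0))"
  unfolding clear_def
proof (induction "\<sigma> i" arbitrary: \<sigma>)
  case 0
  then have "\<sigma>(i := 0) = \<sigma>" by auto
  with 0 show ?case by simp
next
  case (Suc n)
  then have "wp (While i (Dec i)) F (st, \<sigma>(i := n)) = F (st, \<sigma>(i := 0))"
    using Suc(1)[of "\<sigma>(i := n)"] by simp
  then show ?case using Suc(2) by (simp add: wp_While_Suc Suc(2)[symmetric])
qed

text \<open>A target listed twice receives every unit twice, which is how \<open>double\<close>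
  multiplies by two.\<close>

definition pour :: "nat \<Rightarrow> nat list \<Rightarrow> cmd" where
  "pour a ts = While a (foldr (\<lambda>i. Seq (Inc i)) ts (Dec a))"

lemma regs_pour [simp]: "regs (pour a ts) = insert a (set ts)"
proof -
  have "regs (foldr (\<lambda>i. Seq (Inc i)) ts (Dec a)) = insert a (set ts)"
    by (induction ts) auto
  then show ?thesis by (simp add: pour_def)
qed

lemma wp_pour_body:
  assumes "a \<notin> set ts"
  shows "wp (foldr (\<lambda>i. Seq (Inc i)) ts (Dec a)) F (st, \<sigma>) =
    F (st, \<lambda>j. if j = a then \<sigma> a - 1 else \<sigma> j + count_list ts j)"
  using assms
proof (induction ts arbitrary: \<sigma>)
  case Nil
  have "(\<lambda>j. if j = a then \<sigma> a - 1 else \<sigma> j + count_list [] j) = \<sigma>(a := \<sigma> a - 1)" by auto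
  then show ?case by (simp only: foldr.simps id_apply wp.simps prod.case)
next
  case (Cons t ts)
  have "wp (foldr (\<lambda>i. Seq (Inc i)) (t # ts) (Dec a)) F (st, \<sigma>) =
      F (st, \<lambda>j. if j = a then (\<sigma>(t := Suc (\<sigma> t))) a - 1
        else (\<sigma>(t := Suc (\<sigma> t))) j + count_list ts j)"
    using Cons by (simp del: fun_upd_apply)
  also have "(\<lambda>j. if j = a then (\<sigma>(t := Suc (\<sigma> t))) a - 1
        else (\<sigma>(t := Suc (\<sigma> t))) j + count_list ts j) =
      (\<lambda>j. if j = a then \<sigma> a - 1 else \<sigma> j + count_list (t # ts) j)"
    using Cons.prems by auto
  finally show ?case .
qed

lemma wp_pour:
  assumes "a \<notin> set ts"
  shows "wp (pour a ts) F (st, \<sigma>) = F (st, \<lambda>j. if j = a then 0 else \<sigma> j + \<sigma> a * count_list ts j)"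
  unfolding pour_def
proof (induction "\<sigma> a" arbitrary: \<sigma>)
  case 0
  then have "(\<lambda>j. if j = a then 0 else \<sigma> j + \<sigma> a * count_list ts j) = \<sigma>" by auto
  with 0 show ?case by simp
next
  case (Suc n)
  let ?\<sigma> = "\<lambda>j. if j = a then \<sigma> a - 1 else \<sigma> j + count_list ts j"
  have "(\<lambda>j. if j = a then 0 else ?\<sigma> j + ?\<sigma> a * count_list ts j) =
      (\<lambda>j. if j = a then 0 else \<sigma> j + \<sigma> a * count_list ts j)"
    using Suc(2)[symmetric] by auto
  then show ?case
    using Suc(1)[of ?\<sigma>] Suc(2) by (simp add: wp_While_Suc wp_pour_body[OF assms] del: fun_upd_apply)
qed

definition copy :: "nat \<Rightarrow> nat \<Rightarrow> nat \<Rightarrow> cmd" where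
  "copy a b t = Seq (clear b) (Seq (clear t) (Seq (pour a [b, t]) (pour t [a])))"

lemma regs_copy [simp]: "regs (copy a b t) = {a, b, t}"
  by (auto simp: copy_def)

lemma wp_copy:
  assumes "a \<noteq> b" "a \<noteq> t" "b \<noteq> t"
  shows "wp (copy a b t) F (st, \<sigma>) = F (st, \<sigma>(b := \<sigma> a, t := 0))"
proof -
  show ?thesis
    using assms
    by (simp add: copy_def wp_pour del: fun_upd_apply)
      (rule arg_cong[where f = "\<lambda>s. F (st, s)"], auto simp: fun_eq_iff)
qed

text \<open>The scratch register may be the bound itself: \<open>F\<close> does not see that it was
  cleared.\<close>

lemma wp_copy_indep:
  assumes "a \<noteq> b" "a < t" "b < t" "indep t F"
  shows "wp (copy a b t) F (st, \<sigma>) = F (st, \<sigma>(b := \<sigma> a))"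
  using assms by (subst wp_copy) (auto intro!: indepD[OF assms(4)])

subsection \<open>Programs for probabilistic functions\<close>

type_synonym epf = "nat list \<Rightarrow> nat \<Rightarrow> ennreal"

text \<open>Quantifying over \<open>F\<close> expresses the output distribution and the frame
  condition at once: the stack and the registers below \<open>b\<close> other than
  \<open>out\<close> keep their contents, while those from \<open>b\<close> on may end up with
  anything.\<close>

definition realizes :: "cmd \<Rightarrow> nat list \<Rightarrow> nat \<Rightarrow> nat \<Rightarrow> epf \<Rightarrow> bool" where
  "realizes c args out b e \<longleftrightarrow> (\<forall>F st \<sigma>. indep b F \<longrightarrow>
     wp c F (st, \<sigma>) = (\<integral>\<^sup>+y. e (map \<sigma> args) y * F (st, \<sigma>(out := y)) \<partial>count_space UNIV))"

text \<open>All register choices are quantified so that code can be placed beside any registers in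
  use. As \<open>out\<close> may not be an argument, a loop that updates an argument goes through a
  temporary register.\<close>

definition implementable :: "nat \<Rightarrow> epf \<Rightarrow> bool" where
  "implementable k e \<longleftrightarrow> (\<forall>args out b. length args = k \<longrightarrow> set args \<subseteq> {..<b} \<longrightarrow> out < b \<longrightarrow>
     out \<notin> set args \<longrightarrow> (\<exists>c. realizes c args out b e))"

lemma realizesD:
  "realizes c args out b e \<Longrightarrow> indep b F \<Longrightarrow>
    wp c F (st, \<sigma>) = (\<integral>\<^sup>+y. e (map \<sigma> args) y * F (st, \<sigma>(out := y)) \<partial>count_space UNIV)"
  by (simp add: realizes_def)

lemma realizes_cong:
  assumes "\<And>xs. length xs = length args \<Longrightarrow> e xs = e' xs"
  shows "realizes c args out b e \<longleftrightarrow> realizes c args out b e'"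
  using assms by (simp add: realizes_def)

lemma implementable_cong:
  assumes "\<And>xs. length xs = k \<Longrightarrow> e xs = e' xs"
  shows "implementable k e \<longleftrightarrow> implementable k e'"
  using realizes_cong[of _ e e'] assms by (auto simp: implementable_def)

lemma realizes_local:
  assumes "realizes c args out b e" "set args \<subseteq> {..<b}"
  shows "local_prog b c"
  unfolding local_prog_def
proof (intro allI impI indepI)
  fix F st \<sigma> \<sigma>'
  assume F: "indep b F" and eq: "\<forall>j<b. \<sigma> j = (\<sigma>' j :: nat)"
  have 1: "map \<sigma> args = map \<sigma>' args" using assms(2) eq by (auto simp: subset_iff)
  have 2: "F (st, \<sigma>(out := y)) = F (st, \<sigma>'(out := y))" for y
    using eq by (intro indepD[OF F]) auto
  show "wp c F (st, \<sigma>) = wp c F (st, \<sigma>')"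
    by (simp only: realizesD[OF assms(1) F] 1 2)
qed

text \<open>The specification applied to the constant expectation 1 turns \<open>wp_le_1\<close>
  into a bound on the mass.\<close>

lemma implementable_mass:
  assumes "implementable k e" "length xs = k"
  shows "(\<integral>\<^sup>+y. e xs y \<partial>count_space UNIV) \<le> 1"
proof -
  obtain c where c: "realizes c [0..<k] k (Suc k) e"
    using assms(1)[unfolded implementable_def, rule_format, of "[0..<k]" "Suc k" k] by fastforce
  have "wp c (\<lambda>_. 1) ([], nth xs) \<le> 1"
    using wp_le_1[of "\<lambda>_. 1" c] by (auto simp: le_fun_def)
  moreover have "wp c (\<lambda>_. 1) ([], nth xs) = (\<integral>\<^sup>+y. e (map (nth xs) [0..<k]) y \<partial>count_space UNIV)"
    by (subst realizesD[OF c]) (auto simp: indep_def)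
  moreover have "map (nth xs) [0..<k] = xs" using assms(2) map_nth by blast
  ultimately show ?thesis by simp
qed

lemma implementable_deterministic:
  assumes "\<And>args out b. length args = k \<Longrightarrow> set args \<subseteq> {..<b} \<Longrightarrow> out < b \<Longrightarrow> out \<notin> set args \<Longrightarrow>
    \<exists>c. \<forall>F st \<sigma>. indep b F \<longrightarrow> wp c F (st, \<sigma>) = F (st, \<sigma>(out := h (map \<sigma> args)))"
  shows "implementable k (\<lambda>xs y. if y = h xs then 1 else 0)"
  unfolding implementable_def realizes_def nsum_point using assms by simp

lemma implementable_zero: "implementable k (\<lambda>xs y. if y = 0 then 1 else 0)"
proof (rule implementable_deterministic)
  fix args out b
  show "\<exists>c. \<forall>F st \<sigma>. indep b F \<longrightarrow> wp c F (st, \<sigma>) = F (st, \<sigma>(out := 0))"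
    by (rule exI[of _ "clear out"]) simp
qed

lemma implementable_proj:
  assumes "m < n"
  shows "implementable n (\<lambda>xs y. if y = xs ! m then 1 else 0)"
proof (rule implementable_deterministic)
  fix args :: "nat list" and out b
  assume *: "length args = n" "set args \<subseteq> {..<b}" "out < b" "out \<notin> set args"
  with assms have "args ! m < b" "args ! m \<noteq> out" by (auto simp: subset_iff)
  then show "\<exists>c. \<forall>F st \<sigma>. indep b F \<longrightarrow> wp c F (st, \<sigma>) = F (st, \<sigma>(out := map \<sigma> args ! m))"
    using * assms by (intro exI[of _ "copy (args ! m) out b"]) (auto simp: wp_copy_indep)
qed

lemma implementable_succ: "implementable 1 (\<lambda>xs y. if y = hd xs + 1 then 1 else 0)"
proof (rule implementable_deterministic)
  fix args :: "nat list" and out b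
  assume *: "length args = 1" "set args \<subseteq> {..<b}" "out < b" "out \<notin> set args"
  then obtain a where a: "args = [a]" by (auto simp: length_Suc_conv)
  have "wp (Seq (copy a out b) (Inc out)) F (st, \<sigma>) = F (st, \<sigma>(out := hd (map \<sigma> args) + 1))"
    if F: "indep b F" for F st \<sigma>
  proof -
    have "indep b (wp (Inc out) F)"
      using local_regs[of "Inc out" b] * F by (simp add: local_prog_def)
    with a * show ?thesis by (simp add: wp_copy_indep)
  qed
  then show "\<exists>c. \<forall>F st \<sigma>. indep b F \<longrightarrow> wp c F (st, \<sigma>) = F (st, \<sigma>(out := hd (map \<sigma> args) + 1))"
    by blast
qed

lemma implementable_rand: "implementable 1 (\<lambda>xs y. if y = hd xs \<or> y = hd xs + 1 then 1/2 else 0)"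
  unfolding implementable_def
proof (intro allI impI)
  fix args :: "nat list" and out b
  assume *: "length args = 1" "set args \<subseteq> {..<b}" "out < b" "out \<notin> set args"
  then obtain a where a: "args = [a]" by (auto simp: length_Suc_conv)
  have "realizes (Seq (copy a out b) (Toss out)) args out b
      (\<lambda>xs y. if y = hd xs \<or> y = hd xs + 1 then 1/2 else 0)"
    unfolding realizes_def
  proof (intro allI impI)
    fix F st \<sigma> assume F: "indep b F"
    have "indep b (wp (Toss out) F)"
      using local_regs[of "Toss out" b] * F by (simp add: local_prog_def)
    with a * have "wp (Seq (copy a out b) (Toss out)) F (st, \<sigma>) =
        (F (st, \<sigma>(out := Suc (\<sigma> a))) + F (st, \<sigma>(out := \<sigma> a))) / 2"
      by (simp add: wp_copy_indep)
    also have "\<dots> = (\<Sum>y\<in>{\<sigma> a, \<sigma> a + 1}. 1/2 * F (st, \<sigma>(out := y)))"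
      by (simp add: divide_ennreal_def distrib_left mult.commute add.commute)
    also have "\<dots> = (\<integral>\<^sup>+y. (if y = hd (map \<sigma> args) \<or> y = hd (map \<sigma> args) + 1 then 1/2 else 0) *
        F (st, \<sigma>(out := y)) \<partial>count_space UNIV)"
      using a by (subst nn_integral_count_space'[of "{\<sigma> a, \<sigma> a + 1}"]) auto
    finally show "wp (Seq (copy a out b) (Toss out)) F (st, \<sigma>) = \<dots>" .
  qed
  then show "\<exists>c. realizes c args out b (\<lambda>xs y. if y = hd xs \<or> y = hd xs + 1 then 1/2 else 0)" by blast
qed

subsection \<open>Composition\<close>

definition e_comp :: "epf \<Rightarrow> epf list \<Rightarrow> epf" where
  "e_comp f gs xs y = (\<integral>\<^sup>+zs. f zs y * (\<Prod>i<length gs. (gs ! i) xs (zs ! i))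
     \<partial>count_space {zs. length zs = length gs})"

definition put :: "nat \<Rightarrow> nat list \<Rightarrow> (nat \<Rightarrow> nat) \<Rightarrow> nat \<Rightarrow> nat" where
  "put b zs \<sigma> = (\<lambda>j. if b \<le> j \<and> j < b + length zs then zs ! (j - b) else \<sigma> j)"

lemma put_Nil [simp]: "put b [] \<sigma> = \<sigma>"
  by (auto simp: put_def)

lemma put_Cons: "put b (z # zs) \<sigma> = put (Suc b) zs (\<sigma>(b := z))"
  by (auto simp: put_def fun_eq_iff nth_Cons' Suc_le_eq)

lemma put_below: "j < b \<Longrightarrow> put b zs \<sigma> j = \<sigma> j"
  by (simp add: put_def)

lemma map_put: "length zs = n \<Longrightarrow> map (put b zs \<sigma>) [b..<b + n] = zs"
  by (auto simp: put_def intro: nth_equalityI)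

text \<open>Results fill the registers from \<open>b\<close> upwards, while all scratch space starts
  at the fixed \<open>B\<close>. Thus a later function destroys neither the earlier results nor the
  arguments, which lie below \<open>b\<close>.\<close>

lemma implementable_list:
  assumes "\<And>g. g \<in> set gs \<Longrightarrow> implementable (length args) g"
    "set args \<subseteq> {..<b}" "b + length gs \<le> B"
  shows "\<exists>c. local_prog B c \<and> (\<forall>G st \<sigma>. indep B G \<longrightarrow> wp c G (st, \<sigma>) =
    (\<integral>\<^sup>+zs. (\<Prod>i<length gs. (gs ! i) (map \<sigma> args) (zs ! i)) * G (st, put b zs \<sigma>)
      \<partial>count_space {zs. length zs = length gs}))"
  using assms
proof (induction gs arbitrary: b)
  case Nil
  \<comment> \<open>The language has no skip command; clearing a register that the expectation
    ignores acts as one.\<close>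
  let ?c = "clear B"
  have G: "wp ?c G (st, \<sigma>) = G (st, \<sigma>)" if "indep B G" for G st \<sigma>
    unfolding wp_clear using that by (rule indepD) auto
  have "local_prog B ?c"
    unfolding local_prog_def
  proof (intro allI impI indepI)
    fix H st and \<sigma> \<sigma>' :: "nat \<Rightarrow> nat" assume H: "indep B H" and eq: "\<forall>j<B. \<sigma> j = \<sigma>' j"
    show "wp ?c H (st, \<sigma>) = wp ?c H (st, \<sigma>')"
      unfolding G[OF H] by (rule indepD[OF H eq])
  qed
  moreover have "wp ?c G (st, \<sigma>) = (\<integral>\<^sup>+zs. (\<Prod>i<length []. ([] ! i) (map \<sigma> args) (zs ! i)) * G (st, put b zs \<sigma>)
      \<partial>count_space {zs. length zs = length []})" if "indep B G" for G st \<sigma>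
    using G[OF that] by (simp add: nn_integral_count_space_finite)
  ultimately show ?case by blast
next
  case (Cons g gs)
  have "b < B" "set args \<subseteq> {..<B}" "b \<notin> set args"
    using Cons.prems by auto
  then obtain c1 where c1: "realizes c1 args b B g"
    using Cons.prems(1)[of g, unfolded implementable_def, rule_format, of args B b] by auto
  have args: "set args \<subseteq> {..<Suc b}" using Cons.prems(2) by (auto simp: subset_iff)
  obtain c2 where c2: "local_prog B c2" "\<And>G st \<sigma>. indep B G \<Longrightarrow> wp c2 G (st, \<sigma>) =
      (\<integral>\<^sup>+zs. (\<Prod>i<length gs. (gs ! i) (map \<sigma> args) (zs ! i)) * G (st, put (Suc b) zs \<sigma>)
      \<partial>count_space {zs. length zs = length gs})"
    using Cons.IH[OF _ args] Cons.prems by auto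
  have argsB: "set args \<subseteq> {..<B}" using Cons.prems by auto
  have "wp (Seq c1 c2) G (st, \<sigma>) =
      (\<integral>\<^sup>+zs. (\<Prod>i<length (g # gs). ((g # gs) ! i) (map \<sigma> args) (zs ! i)) * G (st, put b zs \<sigma>)
      \<partial>count_space {zs. length zs = length (g # gs)})" if G: "indep B G" for G st \<sigma>
  proof -
    have map_eq: "map (\<sigma>(b := z)) args = map \<sigma> args" for z
      using Cons.prems(2) by auto
    have "wp (Seq c1 c2) G (st, \<sigma>) =
        (\<integral>\<^sup>+z. g (map \<sigma> args) z * wp c2 G (st, \<sigma>(b := z)) \<partial>count_space UNIV)"
      using c2(1) G by (simp add: realizesD[OF c1] local_prog_def)
    also have "\<dots> = (\<integral>\<^sup>+z. \<integral>\<^sup>+zs. g (map \<sigma> args) z * ((\<Prod>i<length gs. (gs ! i) (map \<sigma> args) (zs ! i)) *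
        G (st, put (Suc b) zs (\<sigma>(b := z)))) \<partial>count_space {zs. length zs = length gs} \<partial>count_space UNIV)"
      by (simp only: c2(2)[OF G] map_eq nsum_cmult)
    also have "\<dots> = (\<integral>\<^sup>+zs. (\<Prod>i<length (g # gs). ((g # gs) ! i) (map \<sigma> args) (zs ! i)) *
        G (st, put b zs \<sigma>) \<partial>count_space {zs. length zs = length (g # gs)})"
      unfolding length_Cons nsum_lists_Suc
      by (simp add: prod.lessThan_Suc_shift put_Cons mult.assoc del: prod.lessThan_Suc)
    finally show ?thesis .
  qed
  moreover have "local_prog B (Seq c1 c2)"
    using realizes_local[OF c1 argsB] c2(1) by (rule local_Seq)
  ultimately show ?case by blast
qed

lemma implementable_comp:
  assumes f: "implementable (length gs) f" and gs: "\<And>g. g \<in> set gs \<Longrightarrow> implementable k g"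
  shows "implementable k (e_comp f gs)"
  unfolding implementable_def
proof (intro allI impI)
  fix args :: "nat list" and out b
  assume *: "length args = k" "set args \<subseteq> {..<b}" "out < b" "out \<notin> set args"
  let ?n = "length gs" and ?L = "{zs :: nat list. length zs = length gs}"
  have "\<And>g. g \<in> set gs \<Longrightarrow> implementable (length args) g"
    using gs * by simp
  from implementable_list[OF this *(2) order_refl]
  obtain c1 where c1: "\<And>G st \<sigma>. indep (b + ?n) G \<Longrightarrow> wp c1 G (st, \<sigma>) =
      (\<integral>\<^sup>+zs. (\<Prod>i<?n. (gs ! i) (map \<sigma> args) (zs ! i)) * G (st, put b zs \<sigma>) \<partial>count_space ?L)"
    by blast
  have "\<exists>c2. realizes c2 [b..<b + ?n] out (b + ?n) f"
    using f[unfolded implementable_def, rule_format, of "[b..<b + ?n]" "b + ?n" out] * by fastforce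
  then obtain c2 where c2: "realizes c2 [b..<b + ?n] out (b + ?n) f" ..
  have loc: "local_prog (b + ?n) c2"
    by (rule realizes_local[OF c2]) auto
  have "wp (Seq c1 c2) F (st, \<sigma>) =
      (\<integral>\<^sup>+y. e_comp f gs (map \<sigma> args) y * F (st, \<sigma>(out := y)) \<partial>count_space UNIV)"
    if F: "indep b F" for F st \<sigma>
  proof -
    let ?P = "\<lambda>zs. \<Prod>i<?n. (gs ! i) (map \<sigma> args) (zs ! i)"
    have F': "indep (b + ?n) F" using F by (rule indep_mono) simp
    have up: "F (st, (put b zs \<sigma>)(out := y)) = F (st, \<sigma>(out := y))" for zs y
      by (rule indepD[OF F]) (auto simp: put_below)
    have "wp (Seq c1 c2) F (st, \<sigma>) =
        (\<integral>\<^sup>+zs. ?P zs * wp c2 F (st, put b zs \<sigma>) \<partial>count_space ?L)"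
      using loc F' by (simp add: c1 local_prog_def)
    also have "\<dots> = (\<integral>\<^sup>+zs. ?P zs * (\<integral>\<^sup>+y. f zs y * F (st, \<sigma>(out := y)) \<partial>count_space UNIV) \<partial>count_space ?L)"
      by (intro nn_integral_cong) (simp add: realizesD[OF c2 F'] map_put up)
    also have "\<dots> = (\<integral>\<^sup>+zs. \<integral>\<^sup>+y. f zs y * ?P zs * F (st, \<sigma>(out := y)) \<partial>count_space UNIV \<partial>count_space ?L)"
      by (simp only: nsum_cmult[symmetric]) (simp add: ac_simps)
    also have "\<dots> = (\<integral>\<^sup>+y. \<integral>\<^sup>+zs. f zs y * ?P zs * F (st, \<sigma>(out := y)) \<partial>count_space ?L \<partial>count_space UNIV)"
      by (rule nsum_swap)
    also have "\<dots> = (\<integral>\<^sup>+y. e_comp f gs (map \<sigma> args) y * F (st, \<sigma>(out := y)) \<partial>count_space UNIV)"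
      by (simp only: nsum_multc e_comp_def)
    finally show ?thesis .
  qed
  then show "\<exists>c. realizes c args out b (e_comp f gs)"
    unfolding realizes_def by blast
qed

subsection \<open>Primitive recursion\<close>

fun e_rec_aux :: "epf \<Rightarrow> epf \<Rightarrow> nat list \<Rightarrow> nat \<Rightarrow> nat \<Rightarrow> ennreal" where
  "e_rec_aux f g xs 0 = f xs"
| "e_rec_aux f g xs (Suc n) =
     (\<lambda>w. \<integral>\<^sup>+z. e_rec_aux f g xs n z * g (xs @ [n, z]) w \<partial>count_space UNIV)"

definition e_rec :: "epf \<Rightarrow> epf \<Rightarrow> epf" where
  "e_rec f g xs = e_rec_aux f g (butlast xs) (last xs)"

text \<open>The last \<open>M\<close> rounds of the recursion, started in round \<open>n\<close> with the intermediate value \<open>a\<close>.\<close>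

fun rounds :: "epf \<Rightarrow> nat list \<Rightarrow> nat \<Rightarrow> nat \<Rightarrow> nat \<Rightarrow> nat \<Rightarrow> ennreal" where
  "rounds g xs 0 n a w = (if w = a then 1 else 0)"
| "rounds g xs (Suc M) n a w =
     (\<integral>\<^sup>+z. g (xs @ [n, a]) z * rounds g xs M (Suc n) z w \<partial>count_space UNIV)"

text \<open>The definition of recursion peels off the last round, whereas a loop peels off the
  first. Splitting at an intermediate value, as in the Chapman-Kolmogorov equation, reconciles the
  two.\<close>

lemma e_rec_aux_rounds:
  "e_rec_aux f g xs (n + M) w = (\<integral>\<^sup>+a. e_rec_aux f g xs n a * rounds g xs M n a w \<partial>count_space UNIV)"
proof (induction M arbitrary: n)
  case 0
  have "(\<integral>\<^sup>+a. e_rec_aux f g xs n a * rounds g xs 0 n a w \<partial>count_space UNIV) =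
      (\<integral>\<^sup>+a. (if a = w then 1 else 0) * e_rec_aux f g xs n a \<partial>count_space UNIV)"
    by (intro nn_integral_cong) auto
  also have "\<dots> = e_rec_aux f g xs n w" by (rule nsum_point)
  finally show ?case by simp
next
  case (Suc M)
  have "e_rec_aux f g xs (n + Suc M) w = e_rec_aux f g xs (Suc n + M) w" by simp
  also have "\<dots> = (\<integral>\<^sup>+z. e_rec_aux f g xs (Suc n) z * rounds g xs M (Suc n) z w \<partial>count_space UNIV)"
    by (rule Suc)
  also have "\<dots> = (\<integral>\<^sup>+z. \<integral>\<^sup>+a. e_rec_aux f g xs n a * (g (xs @ [n, a]) z * rounds g xs M (Suc n) z w)
      \<partial>count_space UNIV \<partial>count_space UNIV)"
    by (simp add: nsum_multc[symmetric] mult.assoc)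
  also have "\<dots> = (\<integral>\<^sup>+a. \<integral>\<^sup>+z. e_rec_aux f g xs n a * (g (xs @ [n, a]) z * rounds g xs M (Suc n) z w)
      \<partial>count_space UNIV \<partial>count_space UNIV)"
    by (rule nsum_swap)
  also have "\<dots> = (\<integral>\<^sup>+a. e_rec_aux f g xs n a * rounds g xs (Suc M) n a w \<partial>count_space UNIV)"
    by (simp add: nsum_cmult)
  finally show ?case .
qed

text \<open>The loop counts \<open>m\<close> down and the round index \<open>n\<close> up, so the
  induction is on the rounds that remain, as in \<open>rounds\<close>. The new value passes through
  \<open>tmp\<close> because \<open>r\<close> is an argument of \<open>cg\<close>.\<close>

lemma wp_rec_loop:
  assumes cg: "realizes cg (us @ [n, r]) tmp B g"
    and us: "\<And>i. i \<in> set us \<Longrightarrow> i < n" and regs: "n < r" "r < m" "m < tmp" "tmp < B"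
    and out: "out < n" and F: "indep n F"
  shows "wp (While m (Seq cg (Seq (copy tmp r B) (Seq (Inc n) (Dec m))))) (\<lambda>(st, \<sigma>). F (st, \<sigma>(out := \<sigma> r))) (st, \<sigma>) =
    (\<integral>\<^sup>+w. rounds g (map \<sigma> us) (\<sigma> m) (\<sigma> n) (\<sigma> r) w * F (st, \<sigma>(out := w)) \<partial>count_space UNIV)"
    (is "wp ?loop ?G _ = _")
proof (induction "\<sigma> m" arbitrary: \<sigma>)
  case 0
  then show ?case by (simp add: nsum_point)
next
  case (Suc M)
  have G: "indep B ?G"
    using regs out by (auto intro!: indepI indepD[OF F])
  have loc: "local_prog B cg"
    using us regs by (intro realizes_local[OF cg]) fastforce
  have copy: "wp (copy tmp r B) H (st, \<sigma>) = H (st, \<sigma>(r := \<sigma> tmp))" if "indep B H" for H st \<sigma>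
    using that regs by (intro wp_copy_indep) auto
  have loc_copy: "local_prog B (copy tmp r B)"
    unfolding local_prog_def
  proof (intro allI impI indepI)
    fix H st and \<sigma> \<sigma>' :: "nat \<Rightarrow> nat" assume H: "indep B H" and eq: "\<forall>j<B. \<sigma> j = \<sigma>' j"
    show "wp (copy tmp r B) H (st, \<sigma>) = wp (copy tmp r B) H (st, \<sigma>')"
      unfolding copy[OF H] using eq regs by (intro indepD[OF H]) auto
  qed
  have loc_tail: "local_prog B (Seq (Inc n) (Dec m))"
    using regs by (intro local_regs) auto
  have W: "indep B (wp ?loop ?G)"
    using local_While[OF _ local_Seq[OF loc local_Seq[OF loc_copy loc_tail]], of m] G regs
    by (simp add: local_prog_def)
  then have W1: "indep B (wp (Seq (Inc n) (Dec m)) (wp ?loop ?G))"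
    using loc_tail unfolding local_prog_def by blast
  then have W2: "indep B (wp (Seq (copy tmp r B) (Seq (Inc n) (Dec m))) (wp ?loop ?G))"
    using loc_copy unfolding local_prog_def by simp
  let ?xs = "map \<sigma> us"
  have as_eq: "map (\<sigma>(tmp := z, r := z, n := Suc (\<sigma> n), m := M)) us = ?xs" for z
    using us regs by fastforce
  have F_eq: "F (st, \<sigma>(tmp := z, r := z, n := Suc (\<sigma> n), m := M, out := w)) = F (st, \<sigma>(out := w))" for z w
    using regs by (intro indepD[OF F]) auto
  have tail: "wp (Seq (copy tmp r B) (Seq (Inc n) (Dec m))) (wp ?loop ?G) (st, \<sigma>(tmp := z)) =
      wp ?loop ?G (st, \<sigma>(tmp := z, r := z, n := Suc (\<sigma> n), m := M))" for z
    unfolding wp.simps(6)[of "copy tmp r B"] copy[OF W1] using regs Suc(2)[symmetric] by simp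
  have "wp ?loop ?G (st, \<sigma>) =
      wp cg (wp (Seq (copy tmp r B) (Seq (Inc n) (Dec m))) (wp ?loop ?G)) (st, \<sigma>)"
    using Suc(2) by (subst wp_While_Suc) auto
  also have "\<dots> = (\<integral>\<^sup>+z. g (?xs @ [\<sigma> n, \<sigma> r]) z *
      wp ?loop ?G (st, \<sigma>(tmp := z, r := z, n := Suc (\<sigma> n), m := M)) \<partial>count_space UNIV)"
    unfolding realizesD[OF cg W2] tail by simp
  also have "\<dots> = (\<integral>\<^sup>+z. g (?xs @ [\<sigma> n, \<sigma> r]) z *
      (\<integral>\<^sup>+w. rounds g ?xs M (Suc (\<sigma> n)) z w * F (st, \<sigma>(out := w)) \<partial>count_space UNIV) \<partial>count_space UNIV)"
    using Suc(1)[of "\<sigma>(tmp := z, r := z, n := Suc (\<sigma> n), m := M)" for z] regs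
    by (simp add: as_eq F_eq)
  also have "\<dots> = (\<integral>\<^sup>+z. \<integral>\<^sup>+w. g (?xs @ [\<sigma> n, \<sigma> r]) z * rounds g ?xs M (Suc (\<sigma> n)) z w *
      F (st, \<sigma>(out := w)) \<partial>count_space UNIV \<partial>count_space UNIV)"
    by (simp add: nsum_cmult[symmetric] mult.assoc)
  also have "\<dots> = (\<integral>\<^sup>+w. \<integral>\<^sup>+z. g (?xs @ [\<sigma> n, \<sigma> r]) z * rounds g ?xs M (Suc (\<sigma> n)) z w *
      F (st, \<sigma>(out := w)) \<partial>count_space UNIV \<partial>count_space UNIV)"
    by (rule nsum_swap)
  also have "\<dots> = (\<integral>\<^sup>+w. rounds g ?xs (\<sigma> m) (\<sigma> n) (\<sigma> r) w * F (st, \<sigma>(out := w)) \<partial>count_space UNIV)"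
    by (simp add: nsum_multc Suc(2)[symmetric])
  finally show ?case .
qed

lemma implementable_rec:
  assumes f: "implementable k f" and g: "implementable (k + 2) g"
  shows "implementable (k + 1) (e_rec f g)"
  unfolding implementable_def
proof (intro allI impI)
  fix args :: "nat list" and out b
  assume *: "length args = k + 1" "set args \<subseteq> {..<b}" "out < b" "out \<notin> set args"
  define us a where "us = butlast args" and "a = last args"
  have args: "args = us @ [a]" using *(1) by (cases args rule: rev_cases) (auto simp: us_def a_def)
  \<comment> \<open>\<open>b\<close> holds the round index, \<open>r\<close> the current value,
    \<open>m\<close> the number of rounds left and \<open>tmp\<close> the next value; scratch space
    starts at \<open>B\<close>.\<close>
  define r m tmp B where "r = Suc b" and "m = Suc r" and "tmp = Suc m" and "B = Suc tmp"
  have regs: "b < r" "r < m" "m < tmp" "tmp < B"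
    by (auto simp: r_def m_def tmp_def B_def)
  have us: "\<And>i. i \<in> set us \<Longrightarrow> i < b" "length us = k" and a: "a < b" "a \<notin> {b, r, m, tmp, B}"
    using * regs by (auto simp: args)
  have us_B: "i < B \<and> i \<noteq> r \<and> i \<noteq> tmp" if "i \<in> set us" for i
    using us(1)[OF that] regs by linarith
  then have "length us = k" "set us \<subseteq> {..<B}" "r < B" "r \<notin> set us"
    using us(2) regs by auto
  then obtain cf where cf: "realizes cf us r B f"
    using f unfolding implementable_def by blast
  have "length (us @ [b, r]) = k + 2" "set (us @ [b, r]) \<subseteq> {..<B}" "tmp < B" "tmp \<notin> set (us @ [b, r])"
    using us(2) us_B regs by auto
  then obtain cg where cg: "realizes cg (us @ [b, r]) tmp B g"
    using g unfolding implementable_def by blast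
  let ?loop = "While m (Seq cg (Seq (copy tmp r B) (Seq (Inc b) (Dec m))))"
  let ?rest = "Seq (clear b) (Seq cf (Seq ?loop (copy r out B)))"
  have "realizes (Seq (copy a m B) ?rest) args out b (e_rec f g)"
    unfolding realizes_def
  proof (intro allI impI)
    fix F st and \<sigma> :: "nat \<Rightarrow> nat" assume F: "indep b F"
    have FB: "indep B F" using F by (rule indep_mono) (use regs in simp)
    have copy_out: "wp (copy r out B) F = (\<lambda>(st, \<sigma>). F (st, \<sigma>(out := \<sigma> r)))"
      using FB regs *(3) by (auto simp: fun_eq_iff wp_copy_indep)
    have loop: "wp (Seq ?loop (copy r out B)) F (st, \<sigma>) =
        (\<integral>\<^sup>+w. rounds g (map \<sigma> us) (\<sigma> m) (\<sigma> b) (\<sigma> r) w * F (st, \<sigma>(out := w)) \<partial>count_space UNIV)" for st \<sigma>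
      unfolding wp.simps(6)[of ?loop] copy_out by (rule wp_rec_loop[OF cg us(1) regs *(3) F])
    have F_cong: "F (st, \<sigma>(out := w)) = F (st, \<sigma>'(out := w))" if "\<forall>j<b. \<sigma> j = \<sigma>' j" for st \<sigma> \<sigma>' w
      using that by (intro indepD[OF F]) auto
    have us_cong: "map \<sigma> us = map \<sigma>' us" if "\<forall>j<b. \<sigma> j = \<sigma>' j" for \<sigma> \<sigma>' :: "nat \<Rightarrow> nat"
      using that us(1) by auto
    \<comment> \<open>\<open>copy\<close> uses register \<open>B\<close> itself, so
      \<open>local_regs\<close> does not apply; independence is read off the formula in
      \<open>loop\<close>.\<close>
    have "indep B (wp (Seq ?loop (copy r out B)) F)"
    proof (rule indepI)
      fix st and \<sigma> \<sigma>' :: "nat \<Rightarrow> nat" assume eq: "\<forall>j<B. \<sigma> j = \<sigma>' j"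
      then have 1: "\<forall>j<b. \<sigma> j = \<sigma>' j" and 2: "\<sigma> m = \<sigma>' m" "\<sigma> b = \<sigma>' b" "\<sigma> r = \<sigma>' r"
        using regs by auto
      show "wp (Seq ?loop (copy r out B)) F (st, \<sigma>) = wp (Seq ?loop (copy r out B)) F (st, \<sigma>')"
        by (simp only: loop us_cong[OF 1] F_cong[OF 1] 2)
    qed
    note cf_spec = realizesD[OF cf this]
    have rest: "wp ?rest F (st, \<sigma>) =
        (\<integral>\<^sup>+w. e_rec_aux f g (map \<sigma> us) (\<sigma> m) w * F (st, \<sigma>(out := w)) \<partial>count_space UNIV)" for st \<sigma>
    proof -
      have 1: "map (\<sigma>(b := 0)) us = map \<sigma> us" "map (\<sigma>(b := 0, r := z)) us = map \<sigma> us" for z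
        using us(1) us_B by auto
      have 2: "F (st, \<sigma>(b := 0, r := z, out := w)) = F (st, \<sigma>(out := w))" for z w
        by (rule F_cong) (use regs in auto)
      have "wp ?rest F (st, \<sigma>) = wp cf (wp (Seq ?loop (copy r out B)) F) (st, \<sigma>(b := 0))"
        by simp
      also have "\<dots> = (\<integral>\<^sup>+z. f (map \<sigma> us) z * (\<integral>\<^sup>+w. rounds g (map \<sigma> us) (\<sigma> m) 0 z w *
          F (st, \<sigma>(out := w)) \<partial>count_space UNIV) \<partial>count_space UNIV)"
        unfolding cf_spec loop 1 2 using regs by simp
      also have "\<dots> = (\<integral>\<^sup>+z. \<integral>\<^sup>+w. f (map \<sigma> us) z * rounds g (map \<sigma> us) (\<sigma> m) 0 z w *
          F (st, \<sigma>(out := w)) \<partial>count_space UNIV \<partial>count_space UNIV)"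
        by (simp only: nsum_cmult[symmetric] mult.assoc)
      also have "\<dots> = (\<integral>\<^sup>+w. \<integral>\<^sup>+z. f (map \<sigma> us) z * rounds g (map \<sigma> us) (\<sigma> m) 0 z w *
          F (st, \<sigma>(out := w)) \<partial>count_space UNIV \<partial>count_space UNIV)"
        by (rule nsum_swap)
      also have "\<dots> = (\<integral>\<^sup>+w. e_rec_aux f g (map \<sigma> us) (\<sigma> m) w * F (st, \<sigma>(out := w)) \<partial>count_space UNIV)"
        using e_rec_aux_rounds[of f g "map \<sigma> us" 0 "\<sigma> m"] by (simp only: nsum_multc) simp
      finally show ?thesis .
    qed
    have "indep B (wp ?rest F)"
    proof (rule indepI)
      fix st and \<sigma> \<sigma>' :: "nat \<Rightarrow> nat" assume eq: "\<forall>j<B. \<sigma> j = \<sigma>' j"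
      then have 1: "\<forall>j<b. \<sigma> j = \<sigma>' j" and 2: "\<sigma> m = \<sigma>' m" using regs by auto
      show "wp ?rest F (st, \<sigma>) = wp ?rest F (st, \<sigma>')"
        by (simp only: rest us_cong[OF 1] F_cong[OF 1] 2)
    qed
    then have "wp (Seq (copy a m B) ?rest) F (st, \<sigma>) = wp ?rest F (st, \<sigma>(m := \<sigma> a))"
      using a regs by (subst wp.simps(6), subst wp_copy_indep) auto
    also have "\<dots> = (\<integral>\<^sup>+w. e_rec_aux f g (map \<sigma> us) (\<sigma> a) w * F (st, \<sigma>(out := w)) \<partial>count_space UNIV)"
    proof -
      have eq: "\<forall>j<b. (\<sigma>(m := \<sigma> a)) j = \<sigma> j" using regs by auto
      show ?thesis unfolding rest us_cong[OF eq] F_cong[OF eq] by simp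
    qed
    also have "\<dots> = (\<integral>\<^sup>+w. e_rec f g (map \<sigma> args) w * F (st, \<sigma>(out := w)) \<partial>count_space UNIV)"
      by (simp add: e_rec_def args)
    finally show "wp (Seq (copy a m B) ?rest) F (st, \<sigma>) = \<dots>" .
  qed
  then show "\<exists>c. realizes c args out b (e_rec f g)" ..
qed

subsection \<open>Minimization\<close>

definition e_mu :: "epf \<Rightarrow> epf" where
  "e_mu f xs y = f (xs @ [y]) 0 * (\<Prod>z<y. \<integral>\<^sup>+k. f (xs @ [z]) k \<partial>count_space {0<..})"

text \<open>The least solution of \<open>U n = a n + p n * U (n + 1)\<close>.\<close>

definition search :: "(nat \<Rightarrow> ennreal) \<Rightarrow> (nat \<Rightarrow> ennreal) \<Rightarrow> nat \<Rightarrow> ennreal" where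
  "search a p n = (\<integral>\<^sup>+j. (\<Prod>i<j. p (n + i)) * a (n + j) \<partial>count_space UNIV)"

lemma search_unfold: "search a p n = a n + p n * search a p (Suc n)"
proof -
  have "search a p n = a n + (\<integral>\<^sup>+j. (\<Prod>i<Suc j. p (n + i)) * a (n + Suc j) \<partial>count_space UNIV)"
    unfolding search_def by (subst nsum_shift_Suc) simp
  also have "(\<integral>\<^sup>+j. (\<Prod>i<Suc j. p (n + i)) * a (n + Suc j) \<partial>count_space UNIV) =
      (\<integral>\<^sup>+j. p n * ((\<Prod>i<j. p (Suc n + i)) * a (Suc n + j)) \<partial>count_space UNIV)"
    by (simp add: prod.lessThan_Suc_shift mult.assoc del: prod.lessThan_Suc)
  finally show ?thesis by (simp only: nsum_cmult search_def)
qed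

text \<open>A series of nonnegative terms is the supremum of its partial sums, and these lie below
  \<open>U n\<close> by induction on their length, for all \<open>n\<close> simultaneously.\<close>

lemma search_least:
  assumes "\<And>n. a n + p n * U (Suc n) \<le> U n"
  shows "search a p n \<le> U n"
proof -
  have "(\<Sum>j<N. (\<Prod>i<j. p (n + i)) * a (n + j)) \<le> U n" for N n
  proof (induction N arbitrary: n)
    case (Suc N)
    have "(\<Sum>j<Suc N. (\<Prod>i<j. p (n + i)) * a (n + j)) =
        a n + p n * (\<Sum>j<N. (\<Prod>i<j. p (Suc n + i)) * a (Suc n + j))"
      by (simp add: sum.lessThan_Suc_shift prod.lessThan_Suc_shift mult.assoc sum_distrib_left
          del: sum.lessThan_Suc prod.lessThan_Suc)
    also have "\<dots> \<le> a n + p n * U (Suc n)"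
      by (intro add_left_mono mult_left_mono Suc) simp
    also have "\<dots> \<le> U n" by (rule assms)
    finally show ?case .
  qed simp
  then show ?thesis
    unfolding search_def nn_integral_count_space_nat suminf_eq_SUP by (intro SUP_least)
qed

text \<open>\<open>b\<close> runs through the candidates and \<open>r\<close> holds the value of
  \<open>f\<close> at the current one. The pre-expectation of the loop is guessed to be
  \<open>C\<close> and confirmed from both sides: \<open>C\<close> is a pre-fixed point, and the
  loop provides a solution of the recurrence of which \<open>search\<close> is the least.\<close>

lemma implementable_mu:
  assumes f: "implementable (k + 1) f"
  shows "implementable k (e_mu f)"
  unfolding implementable_def
proof (intro allI impI)
  fix args :: "nat list" and out b
  assume *: "length args = k" "set args \<subseteq> {..<b}" "out < b" "out \<notin> set args"
  define r B where "r = Suc b" and "B = Suc r"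
  have regs: "b < r" "r < B" by (auto simp: r_def B_def)
  have "length (args @ [b]) = k + 1" "set (args @ [b]) \<subseteq> {..<B}" "r < B" "r \<notin> set (args @ [b])"
    using * regs by fastforce+
  then obtain cf where cf: "realizes cf (args @ [b]) r B f"
    using f unfolding implementable_def by blast
  have loc: "local_prog B cf"
    using * regs by (intro realizes_local[OF cf]) fastforce
  let ?body = "Seq (Inc b) cf"
  let ?c = "Seq (clear b) (Seq cf (Seq (While r ?body) (copy b out B)))"
  have "realizes ?c args out b (e_mu f)"
    unfolding realizes_def
  proof (intro allI impI)
    fix F st and \<sigma> :: "nat \<Rightarrow> nat" assume F: "indep b F"
    have FB: "indep B F" using F by (rule indep_mono) (use regs in simp)
    \<comment> \<open>\<open>a\<close> weights the payoff for stopping at \<open>y\<close> with the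
      probability of the value 0 there; \<open>p\<close> is the probability of going on to the next
      candidate.\<close>
    define a where "a = (\<lambda>st \<sigma> y. f (map \<sigma> args @ [y]) 0 * F (st, \<sigma>(out := y)))"
    define p where "p = (\<lambda>\<sigma> y. \<integral>\<^sup>+k. f (map \<sigma> args @ [y]) k \<partial>count_space {0<..})"
    define G where "G = (\<lambda>(st, \<sigma>). F (st, \<sigma>(out := \<sigma> b)))"
    \<comment> \<open>At the loop test candidate \<open>\<sigma> b\<close> has already been
      evaluated, so for nonzero \<open>r\<close> the search resumes at its successor.\<close>
    define C where "C = (\<lambda>(st, \<sigma>). if \<sigma> r = 0 then G (st, \<sigma>) else search (a st \<sigma>) (p \<sigma>) (Suc (\<sigma> b)))"
    have copy_out: "wp (copy b out B) F = G"
      using FB regs *(3) by (auto simp: fun_eq_iff G_def wp_copy_indep)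
    have cong: "map \<sigma> args = map \<sigma>' args" "F (st, \<sigma>(out := w)) = F (st, \<sigma>'(out := w))"
      "a st \<sigma> = a st \<sigma>'" "p \<sigma> = p \<sigma>'"
      if "\<forall>j<b. \<sigma> j = \<sigma>' j" for st \<sigma> \<sigma>' w
    proof -
      show 1: "map \<sigma> args = map \<sigma>' args" using that *(2) by auto
      have 2: "F (st, \<sigma>(out := w)) = F (st, \<sigma>'(out := w))" for w
        using that by (intro indepD[OF F]) auto
      show "F (st, \<sigma>(out := w)) = F (st, \<sigma>'(out := w))" by (rule 2)
      show "a st \<sigma> = a st \<sigma>'" "p \<sigma> = p \<sigma>'" unfolding a_def p_def 1 2 by rule+
    qed
    have G_indep: "indep B G"
    proof (rule indepI)
      fix st and \<sigma> \<sigma>' :: "nat \<Rightarrow> nat" assume "\<forall>j<B. \<sigma> j = \<sigma>' j"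
      then have "\<forall>j<b. \<sigma> j = \<sigma>' j" "\<sigma> b = \<sigma>' b" using regs by auto
      then show "G (st, \<sigma>) = G (st, \<sigma>')" using cong(2)[of \<sigma> \<sigma>' st "\<sigma> b"] by (simp add: G_def)
    qed
    have C_indep: "indep B C"
    proof (rule indepI)
      fix st and \<sigma> \<sigma>' :: "nat \<Rightarrow> nat" assume eq: "\<forall>j<B. \<sigma> j = \<sigma>' j"
      then have "\<forall>j<b. \<sigma> j = \<sigma>' j" "\<sigma> b = \<sigma>' b" "\<sigma> r = \<sigma>' r" using regs by auto
      then show "C (st, \<sigma>) = C (st, \<sigma>')"
        using cong(3,4)[of \<sigma> \<sigma>'] indepD[OF G_indep eq] by (simp add: C_def)
    qed
    have cf_spec: "wp cf H (st, \<sigma>(b := n)) =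
        f (map \<sigma> args @ [n]) 0 * H (st, \<sigma>(b := n, r := 0)) +
        (\<integral>\<^sup>+k. f (map \<sigma> args @ [n]) k * H (st, \<sigma>(b := n, r := k)) \<partial>count_space {0<..})"
      if "indep B H" for H st \<sigma> n
    proof -
      have "map (\<sigma>(b := n)) (args @ [b]) = map \<sigma> args @ [n]" using *(2) by auto
      then show ?thesis by (simp only: realizesD[OF cf that] nsum_split_0)
    qed
    have below: "\<forall>j<b. (\<sigma>(b := n, r := k)) j = \<sigma> j" for \<sigma> :: "nat \<Rightarrow> nat" and n k
      using regs by auto
    have G_eq: "f (map \<sigma> args @ [n]) 0 * G (st, \<sigma>(b := n, r := 0)) = a st \<sigma> n" for st \<sigma> n
    proof -
      have "F (st, \<sigma>(b := n, r := 0, out := n)) = F (st, \<sigma>(out := n))"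
        by (rule cong(2)[OF below])
      then show ?thesis using regs by (simp add: G_def a_def)
    qed
    have cf_C: "wp cf C (st, \<sigma>(b := n)) = search (a st \<sigma>) (p \<sigma>) n" for st \<sigma> n
    proof -
      have "C (st, \<sigma>(b := n, r := 0)) = G (st, \<sigma>(b := n, r := 0))" by (simp add: C_def)
      moreover have "(\<integral>\<^sup>+k. f (map \<sigma> args @ [n]) k * C (st, \<sigma>(b := n, r := k)) \<partial>count_space {0<..}) =
          (\<integral>\<^sup>+k. f (map \<sigma> args @ [n]) k * search (a st \<sigma>) (p \<sigma>) (Suc n) \<partial>count_space {0<..})"
        using regs by (intro nn_integral_cong) (simp add: C_def cong(3,4)[OF below])
      ultimately show ?thesis
        unfolding cf_spec[OF C_indep] by (simp only: G_eq nsum_multc search_unfold[of _ _ n]) (simp add: p_def)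
    qed
    let ?W = "wp (While r ?body) G"
    have W_indep: "indep B ?W"
      using local_While[OF regs(2) local_Seq[OF local_regs[of "Inc b" B] loc]] G_indep regs
      by (simp add: local_prog_def)
    have "?W \<le> C"
      unfolding wp.simps(8)
    proof (rule lfp_lowerbound, rule le_funI)
      fix s :: state obtain st \<sigma> where s: "s = (st, \<sigma>)" by (cases s)
      show "(if snd s r = 0 then G s else wp ?body C s) \<le> C s"
        unfolding s using cf_C[of st \<sigma> "Suc (\<sigma> b)"] by (simp add: C_def)
    qed
    moreover have "C \<le> ?W"
    proof (rule le_funI)
      fix s :: state obtain st \<sigma> where s: "s = (st, \<sigma>)" by (cases s)
      \<comment> \<open>The expectation just before candidate \<open>n\<close> is evaluated. The old
        content of \<open>r\<close> has no influence on it, as \<open>cf\<close> overwrites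
        \<open>r\<close>.\<close>
      define U where "U n = wp cf ?W (st, \<sigma>(b := n))" for n
      have U: "a st \<sigma> n + p \<sigma> n * U (Suc n) \<le> U n" for n
      proof -
        have W: "?W (st, \<sigma>(b := n, r := k)) = U (Suc n)" if "k \<noteq> 0" for k
        proof -
          have "?W (st, \<sigma>(b := n, r := k)) = wp cf ?W (st, \<sigma>(b := n, r := k, b := Suc n))"
            using that regs by (subst wp_While_Suc) auto
          also have "\<sigma>(b := n, r := k, b := Suc n) = \<sigma>(r := k, b := Suc n)" using regs by auto
          also have "wp cf ?W (st, \<sigma>(r := k, b := Suc n)) = U (Suc n)"
          proof -
            have 1: "map (\<sigma>(r := k)) args = map \<sigma> args" using *(2) regs by fastforce
            have 2: "\<sigma>(r := k, b := Suc n, r := k') = \<sigma>(b := Suc n, r := k')" for k'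
              using regs by auto
            show ?thesis unfolding U_def cf_spec[OF W_indep] 1 2 ..
          qed
          finally show ?thesis .
        qed
        have "?W (st, \<sigma>(b := n, r := 0)) = G (st, \<sigma>(b := n, r := 0))" by simp
        moreover have "(\<integral>\<^sup>+k. f (map \<sigma> args @ [n]) k * ?W (st, \<sigma>(b := n, r := k)) \<partial>count_space {0<..}) =
            (\<integral>\<^sup>+k. f (map \<sigma> args @ [n]) k * U (Suc n) \<partial>count_space {0<..})"
          using W by (intro nn_integral_cong) simp
        ultimately have "U n = a st \<sigma> n + p \<sigma> n * U (Suc n)"
          unfolding U_def[of n] cf_spec[OF W_indep] by (simp only: G_eq nsum_multc) (simp add: p_def)
        then show ?thesis by simp
      qed
      have "search (a st \<sigma>) (p \<sigma>) (Suc (\<sigma> b)) \<le> U (Suc (\<sigma> b))"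
        by (rule search_least) (rule U)
      moreover have "?W (st, \<sigma>) = U (Suc (\<sigma> b))" if "\<sigma> r \<noteq> 0"
        using that by (simp add: wp_While_Suc U_def)
      ultimately show "C s \<le> ?W s"
        by (auto simp: s C_def)
    qed
    ultimately have W: "?W = C" by (rule antisym)
    have "wp ?c F (st, \<sigma>) = wp cf C (st, \<sigma>(b := 0))"
      by (simp add: copy_out W)
    also have "\<dots> = (\<integral>\<^sup>+y. e_mu f (map \<sigma> args) y * F (st, \<sigma>(out := y)) \<partial>count_space UNIV)"
      unfolding cf_C search_def by (intro nn_integral_cong) (simp add: a_def p_def e_mu_def ac_simps)
    finally show "wp ?c F (st, \<sigma>) = \<dots>" .
  qed
  then show "\<exists>c. realizes c args out b (e_mu f)" ..
qed

subsection \<open>Every function of the class is implementable\<close>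

lemma implementable_le_1:
  assumes "implementable k e" "length xs = k"
  shows "e xs y \<le> 1"
proof -
  have "e xs y \<le> (\<integral>\<^sup>+y. e xs y \<partial>count_space UNIV)"
    by (rule nn_integral_ge_point) simp
  then show ?thesis using implementable_mass[OF assms] by (rule order_trans)
qed

lemma ennreal_infsum_bounded:
  fixes h :: "'a \<Rightarrow> real"
  assumes "\<And>x. x \<in> A \<Longrightarrow> 0 \<le> h x" "(\<integral>\<^sup>+x. ennreal (h x) \<partial>count_space A) \<le> 1"
  shows "ennreal (\<Sum>\<^sub>\<infinity>x\<in>A. h x) = (\<integral>\<^sup>+x. ennreal (h x) \<partial>count_space A)"
proof (rule ennreal_infsum)
  show "(\<integral>\<^sup>+x. ennreal (h x) \<partial>count_space A) < \<infinity>"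
    using assms(2) by (rule le_less_trans) simp
qed (rule assms(1))

abbreviation epf_of :: "pf \<Rightarrow> epf" where
  "epf_of f \<equiv> (\<lambda>xs y. ennreal (f xs y))"

text \<open>Nonnegativity is recorded separately because \<open>ennreal\<close> sends negative reals
  to 0.\<close>

definition implementable_pf :: "nat \<Rightarrow> pf \<Rightarrow> bool" where
  "implementable_pf k f \<longleftrightarrow> implementable k (epf_of f) \<and> (\<forall>xs y. length xs = k \<longrightarrow> 0 \<le> f xs y)"

text \<open>Implementability of the extended version comes first: it bounds each sum by 1, and only
  this bound identifies the real \<open>infsum\<close> with the extended sum.\<close>

lemma implementable_pf_comp:
  assumes f: "implementable_pf (length gs) f" and gs: "\<And>g. g \<in> set gs \<Longrightarrow> implementable_pf k g"
  shows "implementable_pf k (pf_comp f gs)"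
proof -
  let ?e = "e_comp (epf_of f) (map epf_of gs)"
  have impl: "implementable k ?e"
    using f gs by (intro implementable_comp) (auto simp: implementable_pf_def)
  have nonneg: "0 \<le> f zs y * (\<Prod>i<length gs. (gs ! i) xs (zs ! i))"
    if "length xs = k" "length zs = length gs" for xs zs y
    using that f gs by (auto simp: implementable_pf_def intro!: mult_nonneg_nonneg prod_nonneg)
  have eq: "ennreal (pf_comp f gs xs y) = ?e xs y" if xs: "length xs = k" for xs y
  proof -
    have "?e xs y = (\<integral>\<^sup>+zs. ennreal (f zs y * (\<Prod>i<length gs. (gs ! i) xs (zs ! i)))
        \<partial>count_space {zs. length zs = length gs})"
      unfolding e_comp_def length_map
    proof (rule nn_integral_cong)
      fix zs :: "nat list" assume "zs \<in> space (count_space {zs. length zs = length gs})"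
      then have zs: "length zs = length gs" by simp
      have "(\<Prod>i<length gs. (map epf_of gs ! i) xs (zs ! i)) =
          ennreal (\<Prod>i<length gs. (gs ! i) xs (zs ! i))"
        using gs xs by (subst prod_ennreal[symmetric]) (auto simp: implementable_pf_def)
      then show "ennreal (f zs y) * (\<Prod>i<length gs. (map epf_of gs ! i) xs (zs ! i)) =
          ennreal (f zs y * (\<Prod>i<length gs. (gs ! i) xs (zs ! i)))"
        using f zs by (simp add: ennreal_mult' implementable_pf_def)
    qed
    then show ?thesis
      unfolding pf_comp_def using nonneg[OF xs] implementable_le_1[OF impl xs, of y]
      by (subst ennreal_infsum_bounded) auto
  qed
  have "implementable k (epf_of (pf_comp f gs))"
    using impl by (subst implementable_cong[where e' = ?e]) (auto simp: eq fun_eq_iff)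
  moreover have "0 \<le> pf_comp f gs xs y" if "length xs = k" for xs y
    unfolding pf_comp_def using nonneg[OF that] by (intro infsum_nonneg) auto
  ultimately show ?thesis by (simp add: implementable_pf_def)
qed

lemma implementable_pf_rec:
  assumes f: "implementable_pf k f" and g: "implementable_pf (k + 2) g"
  shows "implementable_pf (k + 1) (pf_rec f g)"
proof -
  let ?e = "e_rec (epf_of f) (epf_of g)"
  have impl: "implementable (k + 1) ?e"
    using f g by (intro implementable_rec) (auto simp: implementable_pf_def)
  have aux: "0 \<le> rec_aux f g xs n w \<and> ennreal (rec_aux f g xs n w) = e_rec_aux (epf_of f) (epf_of g) xs n w"
    if xs: "length xs = k" for xs n w
  proof (induction n arbitrary: w)
    case 0
    then show ?case using f xs by (simp add: implementable_pf_def)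
  next
    case (Suc n)
    have nonneg: "0 \<le> rec_aux f g xs n z * g (xs @ [n, z]) w" for z
      using Suc g xs by (simp add: implementable_pf_def)
    have eq: "e_rec_aux (epf_of f) (epf_of g) xs (Suc n) w =
        (\<integral>\<^sup>+z. ennreal (rec_aux f g xs n z * g (xs @ [n, z]) w) \<partial>count_space UNIV)"
      using Suc by (simp add: ennreal_mult')
    \<comment> \<open>The bound for round \<open>Suc n\<close> comes from the recursion being
      implementable as a whole, at the argument list \<open>xs @ [Suc n]\<close>.\<close>
    have "e_rec_aux (epf_of f) (epf_of g) xs (Suc n) w \<le> 1"
      using implementable_le_1[OF impl, of "xs @ [Suc n]" w] xs by (simp add: e_rec_def)
    then show ?case
      using nonneg unfolding eq by (auto intro!: infsum_nonneg ennreal_infsum_bounded)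
  qed
  have eq: "0 \<le> pf_rec f g xs y \<and> ennreal (pf_rec f g xs y) = ?e xs y" if "length xs = k + 1" for xs y
    using that by (simp add: pf_rec_def e_rec_def aux)
  have "implementable (k + 1) (epf_of (pf_rec f g))"
    using impl by (subst implementable_cong[where e' = ?e]) (auto simp: eq fun_eq_iff)
  with eq show ?thesis by (simp add: implementable_pf_def)
qed

lemma implementable_pf_mu:
  assumes f: "implementable_pf (k + 1) f"
  shows "implementable_pf k (pf_mu f)"
proof -
  let ?e = "e_mu (epf_of f)"
  have impl_f: "implementable (k + 1) (epf_of f)" using f by (simp add: implementable_pf_def)
  have impl: "implementable k ?e"
    using impl_f by (rule implementable_mu)
  have pos: "0 \<le> (\<Sum>\<^sub>\<infinity>k\<in>{0<..}. f (xs @ [z]) k) \<and> ennreal (\<Sum>\<^sub>\<infinity>k\<in>{0<..}. f (xs @ [z]) k) =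
      (\<integral>\<^sup>+k. ennreal (f (xs @ [z]) k) \<partial>count_space {0<..})" if xs: "length xs = k" for xs z
  proof -
    have nonneg: "0 \<le> f (xs @ [z]) k" for k using f xs by (simp add: implementable_pf_def)
    have "(\<integral>\<^sup>+k. ennreal (f (xs @ [z]) k) \<partial>count_space {0<..}) \<le>
        (\<integral>\<^sup>+k. ennreal (f (xs @ [z]) k) \<partial>count_space UNIV)"
      unfolding nsum_split_0[of "\<lambda>k. ennreal (f (xs @ [z]) k)"] by simp
    also have "\<dots> \<le> 1"
      using implementable_mass[OF impl_f] xs by simp
    finally show ?thesis
      using nonneg by (auto intro!: infsum_nonneg ennreal_infsum_bounded)
  qed
  have nonneg: "0 \<le> pf_mu f xs y" if "length xs = k" for xs y
    using f pos[OF that] that by (auto simp: pf_mu_def implementable_pf_def intro!: mult_nonneg_nonneg prod_nonneg)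
  have eq: "ennreal (pf_mu f xs y) = ?e xs y" if xs: "length xs = k" for xs y
  proof -
    have "?e xs y = ennreal (f (xs @ [y]) 0) * (\<Prod>z<y. ennreal (\<Sum>\<^sub>\<infinity>k\<in>{0<..}. f (xs @ [z]) k))"
      using pos[OF xs] by (simp add: e_mu_def)
    also have "\<dots> = ennreal (f (xs @ [y]) 0) * ennreal (\<Prod>z<y. \<Sum>\<^sub>\<infinity>k\<in>{0<..}. f (xs @ [z]) k)"
      using pos[OF xs] by (subst prod_ennreal) auto
    also have "\<dots> = ennreal (pf_mu f xs y)"
      using f xs by (simp add: pf_mu_def ennreal_mult' implementable_pf_def)
    finally show ?thesis ..
  qed
  have "implementable k (epf_of (pf_mu f))"
    using impl by (subst implementable_cong[where e' = ?e]) (auto simp: eq fun_eq_iff)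
  with nonneg show ?thesis by (simp add: implementable_pf_def)
qed

lemma PR_implementable_pf: "PR k f \<Longrightarrow> implementable_pf k f"
proof (induction rule: PR.induct)
  case PR_zero
  have "epf_of pf_zero = (\<lambda>xs y. if y = 0 then 1 else 0)" by (auto simp: pf_zero_def fun_eq_iff)
  then show ?case using implementable_zero by (simp add: implementable_pf_def) (simp add: pf_zero_def)
next
  case PR_succ
  have "epf_of pf_succ = (\<lambda>xs y. if y = hd xs + 1 then 1 else 0)" by (auto simp: pf_succ_def fun_eq_iff)
  then show ?case using implementable_succ by (simp add: implementable_pf_def) (simp add: pf_succ_def)
next
  case (PR_proj m n)
  have "epf_of (pf_proj m) = (\<lambda>xs y. if y = xs ! (m - 1) then 1 else 0)"
    by (auto simp: pf_proj_def fun_eq_iff)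
  then show ?case
    using implementable_proj[of "m - 1" n] PR_proj by (simp add: implementable_pf_def) (simp add: pf_proj_def)
next
  case PR_rand
  have half: "ennreal (1/2) = 1/2"
    by (simp add: divide_ennreal_def)
  have "epf_of pf_rand = (\<lambda>xs y. if y = hd xs \<or> y = hd xs + 1 then 1/2 else 0)"
    unfolding pf_rand_def by (intro ext) (simp only: half if_distrib[of ennreal] ennreal_0)
  then show ?case using implementable_rand by (simp add: implementable_pf_def) (simp add: pf_rand_def)
next
  case (PR_comp n f gs k)
  then show ?case by (intro implementable_pf_comp) auto
next
  case (PR_rec k f g)
  then show ?case by (intro implementable_pf_rec)
next
  case (PR_mu k f)
  then show ?case by (intro implementable_pf_mu)
qed

subsection \<open>Reading the input\<close>

definition bits :: "nat \<Rightarrow> bool list" where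
  "bits n = map (\<lambda>d. d = 1) (bin n)"

lemma bits_0 [simp]: "bits 0 = []"
  by (simp add: bits_def)

lemma bits_Suc: "bits (Suc n) = bits (n div 2) @ [odd n]"
  by (simp add: bits_def odd_iff_mod_2_eq_one)

lemma bin_digits: "set (bin n) \<subseteq> {0, 1}"
  by (induction n rule: bin.induct) auto

lemma map_bsym_bits: "map bsym (bits n) = map Sy (bin n)"
  using bin_digits[of n] by (force simp: bits_def bsym_def)

text \<open>Appending a bit in the length-lexicographic numbering of bit strings.\<close>

definition push_bit :: "nat \<Rightarrow> bool \<Rightarrow> nat" where
  "push_bit v b = 2 * v + (if b then 2 else 1)"

text \<open>\<open>bin\<close> is bijective base 2 notation, with the bits 0 and 1 standing for the
  digits 1 and 2, so Horner's rule recovers the number.\<close>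

lemma foldl_bits: "foldl push_bit 0 (bits n) = n"
proof (induction n rule: bin.induct)
  case (2 n)
  then show ?case by (cases "even n") (auto simp: bits_Suc push_bit_def elim!: evenE oddE)
qed simp

lemma bits_inj: "bits m = bits n \<longleftrightarrow> m = n"
  by (metis foldl_bits)

definition doubled :: "bool list \<Rightarrow> bool list" where
  "doubled bs = concat (map (\<lambda>b. [b, b]) bs) @ [False, True]"

definition enc_bits :: "nat list \<Rightarrow> bool list" where
  "enc_bits xs = concat (map (\<lambda>x. doubled (bits x)) xs)"

lemma enc_tuple_bits: "enc_tuple xs = map bsym (enc_bits xs)"
proof (induction xs)
  case (Cons x xs)
  have dup: "map h (concat (map (\<lambda>b. [b, b]) bs)) = concat (map (\<lambda>s. [s, s]) (map h bs))"
    for h :: "'a \<Rightarrow> sym" and bs by (induction bs) auto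
  have "map bsym (concat (map (\<lambda>b. [b, b]) (bits x))) = map Sy (concat (map (\<lambda>b. [b, b]) (bin x)))"
    unfolding dup map_bsym_bits ..
  moreover have "bsym False = Sy 0" "bsym True = Sy 1"
    by (simp_all add: bsym_def)
  ultimately show ?case
    using Cons by (simp add: enc_tuple_def enc_bits_def doubled_def)
qed (simp add: enc_tuple_def enc_bits_def)

definition double :: "nat \<Rightarrow> nat \<Rightarrow> cmd" where
  "double v t = Seq (pour v [t, t]) (pour t [v])"

lemma wp_double:
  assumes "v \<noteq> t" "\<sigma> t = 0"
  shows "wp (double v t) F (st, \<sigma>) = F (st, \<sigma>(v := 2 * \<sigma> v))"
  using assms
  by (simp add: double_def wp_pour del: fun_upd_apply)
    (rule arg_cong[where f = "\<lambda>s. F (st, s)"], auto simp: fun_eq_iff)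

text \<open>Counter \<open>a\<close> receives the number of ones in the next pair of input symbols: 0 and 2 stand
  for a doubled bit, 1 for the terminator.\<close>

definition read_body :: "nat \<Rightarrow> nat \<Rightarrow> nat \<Rightarrow> nat \<Rightarrow> cmd" where
  "read_body v c a t = Seq (clear a) (Seq (Pop a) (Seq (Pop a)
     (Cond a (Seq (Dec a) (Cond a (Seq (double v t) (Seq (Inc v) (Inc v))) (clear c)))
       (Seq (double v t) (Inc v)))))"

lemma wp_read_body:
  assumes "distinct [v, c, a, t]" "\<sigma> t = 0"
  shows "wp (read_body v c a t) F (b # b # st, \<sigma>) =
      F (st, \<sigma>(a := if b then 1 else 0, v := push_bit (\<sigma> v) b))"
    and "wp (read_body v c a t) F (False # True # st, \<sigma>) = F (st, \<sigma>(a := 0, c := 0))"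
  using assms by (auto simp: read_body_def wp_double push_bit_def intro!: arg_cong[where f = F])

text \<open>\<open>c\<close> is the loop flag, raised here and lowered by \<open>read_body\<close>
  at the terminator. The top of the stack is the leftmost input symbol, so the leading digits arrive
  first, as Horner's rule requires.\<close>

definition read_arg :: "nat \<Rightarrow> nat \<Rightarrow> nat \<Rightarrow> nat \<Rightarrow> cmd" where
  "read_arg c a t v = Seq (clear v) (Seq (Inc c) (While c (read_body v c a t)))"

lemma wp_read_loop:
  assumes "distinct [v, c, a, t]" "\<sigma> t = 0" "\<sigma> c \<noteq> 0"
  shows "wp (While c (read_body v c a t)) F (doubled bs @ st, \<sigma>) =
    F (st, \<sigma>(v := foldl push_bit (\<sigma> v) bs, a := 0, c := 0))"
  using assms(2,3)
proof (induction bs arbitrary: \<sigma>)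
  case Nil
  then have "wp (While c (read_body v c a t)) F (doubled [] @ st, \<sigma>) = F (st, \<sigma>(a := 0, c := 0))"
    by (simp add: wp_While_Suc doubled_def wp_read_body(2)[OF assms(1)])
  also have "\<sigma>(a := 0, c := 0) = \<sigma>(v := foldl push_bit (\<sigma> v) [], a := 0, c := 0)" by auto
  finally show ?case .
next
  case (Cons b bs)
  let ?\<sigma> = "\<sigma>(a := if b then 1 else 0, v := push_bit (\<sigma> v) b)"
  have "?\<sigma> t = 0" "?\<sigma> c \<noteq> 0" using Cons.prems assms(1) by auto
  note IH = Cons.IH[OF this]
  have "wp (While c (read_body v c a t)) F (doubled (b # bs) @ st, \<sigma>) =
      wp (While c (read_body v c a t)) F (doubled bs @ st, ?\<sigma>)"
    using Cons.prems by (simp add: wp_While_Suc doubled_def wp_read_body(1)[OF assms(1)])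
  also note IH
  also have "?\<sigma>(v := foldl push_bit (?\<sigma> v) bs, a := 0, c := 0) =
      \<sigma>(v := foldl push_bit (\<sigma> v) (b # bs), a := 0, c := 0)"
    using assms(1) by auto
  finally show ?case .
qed

lemma wp_read_arg:
  assumes "distinct [v, c, a, t]" "\<sigma> t = 0" "\<sigma> c = 0" "\<sigma> a = 0"
  shows "wp (read_arg c a t v) F (doubled (bits x) @ st, \<sigma>) = F (st, \<sigma>(v := x))"
proof -
  have "wp (read_arg c a t v) F (doubled (bits x) @ st, \<sigma>) =
      F (st, (\<sigma>(v := 0, c := 1))(v := foldl push_bit 0 (bits x), a := 0, c := 0))"
    using assms wp_read_loop[OF assms(1), of "\<sigma>(v := 0, c := 1)" F "bits x" st] by (simp add: read_arg_def)
  also have "(\<sigma>(v := 0, c := 1))(v := foldl push_bit 0 (bits x), a := 0, c := 0) = \<sigma>(v := x)"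
    using assms by (auto simp: foldl_bits)
  finally show ?thesis .
qed

text \<open>The closing \<open>clear c\<close> serves as skip: the flag is already 0 at that
  point.\<close>

definition read_args :: "nat \<Rightarrow> nat \<Rightarrow> nat \<Rightarrow> nat list \<Rightarrow> cmd" where
  "read_args c a t vs = foldr (\<lambda>v. Seq (read_arg c a t v)) vs (clear c)"

lemma wp_read_args:
  assumes "v + length xs \<le> c" "c < a" "a < t" "\<sigma> t = 0" "\<sigma> c = 0" "\<sigma> a = 0"
  shows "wp (read_args c a t [v..<v + length xs]) F (enc_bits xs, \<sigma>) = F ([], put v xs \<sigma>)"
  using assms
proof (induction xs arbitrary: v \<sigma>)
  case Nil
  then have "\<sigma>(c := 0) = \<sigma>" by auto
  then show ?case by (simp add: read_args_def enc_bits_def)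
next
  case (Cons x xs)
  have "[v..<v + length (x # xs)] = v # [Suc v..<Suc v + length xs]"
    by (simp add: upt_rec)
  then have "wp (read_args c a t [v..<v + length (x # xs)]) F (enc_bits (x # xs), \<sigma>) =
      wp (read_arg c a t v) (wp (read_args c a t [Suc v..<Suc v + length xs]) F)
        (doubled (bits x) @ enc_bits xs, \<sigma>)"
    by (simp add: read_args_def enc_bits_def)
  also have "\<dots> = wp (read_args c a t [Suc v..<Suc v + length xs]) F (enc_bits xs, \<sigma>(v := x))"
    using Cons.prems by (intro wp_read_arg) auto
  also have "\<dots> = F ([], put (Suc v) xs (\<sigma>(v := x)))"
    using Cons.prems by (intro Cons.IH) auto
  finally show ?case by (simp add: put_Cons)
qed

subsection \<open>Writing the output\<close>

definition halve :: "nat \<Rightarrow> nat \<Rightarrow> nat \<Rightarrow> cmd" where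
  "halve y p q = While y (Seq (Dec y) (Cond p (Seq (Dec p) (Inc q)) (Inc p)))"

text \<open>Each decrement of \<open>y\<close> toggles the parity flag \<open>p\<close>, and each
  return of the flag to 0 is counted in \<open>q\<close>. Arbitrary initial values of
  \<open>p\<close> and \<open>q\<close> make the induction on \<open>y\<close> possible.\<close>

lemma wp_halve:
  assumes "distinct [y, p, q]" "\<sigma> p < 2"
  shows "wp (halve y p q) F (st, \<sigma>) =
    F (st, \<sigma>(y := 0, p := (\<sigma> p + \<sigma> y) mod 2, q := \<sigma> q + (\<sigma> p + \<sigma> y) div 2))"
  using assms(2)
proof (induction "\<sigma> y" arbitrary: \<sigma>)
  case 0
  then have "\<sigma> = \<sigma>(y := 0, p := (\<sigma> p + \<sigma> y) mod 2, q := \<sigma> q + (\<sigma> p + \<sigma> y) div 2)"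
    by (auto simp: fun_eq_iff)
  moreover have "wp (halve y p q) F (st, \<sigma>) = F (st, \<sigma>)" using 0 by (simp add: halve_def)
  ultimately show ?case by (simp only:)
next
  case (Suc n)
  define \<tau> where "\<tau> = (if \<sigma> p = 0 then \<sigma>(y := n, p := 1) else \<sigma>(y := n, p := 0, q := Suc (\<sigma> q)))"
  have sy: "\<sigma> y = Suc n" using Suc(2) by simp
  have p: "\<sigma> p = 0 \<or> \<sigma> p = 1" using Suc.prems by auto
  have "wp (halve y p q) F (st, \<sigma>) = wp (halve y p q) F (st, \<tau>)"
    using assms(1) p unfolding halve_def
    by (auto simp: wp_While_Suc sy \<tau>_def)
  also have "\<dots> = F (st, \<tau>(y := 0, p := (\<tau> p + \<tau> y) mod 2, q := \<tau> q + (\<tau> p + \<tau> y) div 2))"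
    using assms(1) p by (intro Suc(1)) (auto simp: \<tau>_def)
  also have "\<tau>(y := 0, p := (\<tau> p + \<tau> y) mod 2, q := \<tau> q + (\<tau> p + \<tau> y) div 2) =
      \<sigma>(y := 0, p := (\<sigma> p + \<sigma> y) mod 2, q := \<sigma> q + (\<sigma> p + \<sigma> y) div 2)"
    using assms(1) p by (auto simp: \<tau>_def sy fun_eq_iff)
  finally show ?case .
qed

text \<open>The decrement comes first because \<open>bits (Suc n)\<close> ends in the parity of
  \<open>n\<close> and its remaining digits are those of \<open>n div 2\<close>.\<close>

definition emit_body :: "nat \<Rightarrow> nat \<Rightarrow> nat \<Rightarrow> cmd" where
  "emit_body y p q = Seq (Dec y) (Seq (clear p) (Seq (clear q) (Seq (halve y p q)
     (Seq (Cond p (Push True) (Push False)) (pour q [y])))))"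

lemma wp_emit_body:
  assumes "distinct [y, p, q]" "\<sigma> y = Suc n"
  shows "wp (emit_body y p q) F (st, \<sigma>) = F (odd n # st, \<sigma>(y := n div 2, p := n mod 2, q := 0))"
proof -
  let ?\<sigma> = "\<sigma>(y := 0, p := n mod 2, q := n div 2)"
  have "wp (emit_body y p q) F (st, \<sigma>) =
      wp (Seq (Cond p (Push True) (Push False)) (pour q [y])) F (st, ?\<sigma>)"
    using assms by (simp add: emit_body_def wp_halve fun_upd_twist)
  also have "\<dots> = wp (pour q [y]) F (odd n # st, ?\<sigma>)"
    using assms by (cases "even n") (simp_all add: odd_iff_mod_2_eq_one even_iff_mod_2_eq_zero)
  also have "\<dots> = F (odd n # st, \<sigma>(y := n div 2, p := n mod 2, q := 0))"
    using assms by (subst wp_pour) (auto simp: fun_eq_iff intro!: arg_cong[where f = "\<lambda>s. F (odd n # st, s)"])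
  finally show ?thesis .
qed

text \<open>The last digit is produced first and later ones are pushed in front of it, so the stack
  ends up in reading order. The leftovers in \<open>p\<close> and \<open>q\<close> account for the
  assumption \<open>indep p F\<close>.\<close>

lemma wp_emit:
  assumes "y < p" "p < q" and F: "indep p F"
  shows "wp (While y (emit_body y p q)) F (st, \<sigma>) = F (bits (\<sigma> y) @ st, \<sigma>(y := 0))"
proof (induction "\<sigma> y" arbitrary: \<sigma> st rule: less_induct)
  case less
  show ?case
  proof (cases "\<sigma> y")
    case 0
    then have "\<sigma>(y := 0) = \<sigma>" by auto
    with 0 show ?thesis by simp
  next
    case (Suc n)
    let ?\<sigma> = "\<sigma>(y := n div 2, p := n mod 2, q := 0)"
    have "wp (While y (emit_body y p q)) F (st, \<sigma>) = wp (While y (emit_body y p q)) F (odd n # st, ?\<sigma>)"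
      using Suc assms by (subst wp_While_Suc) (auto simp: wp_emit_body)
    also have "\<dots> = F (bits (?\<sigma> y) @ odd n # st, ?\<sigma>(y := 0))"
      using Suc assms by (intro less) auto
    also have "\<dots> = F (bits (\<sigma> y) @ st, \<sigma>(y := 0))"
      using Suc assms by (auto simp: bits_Suc intro!: indepD[OF F])
    finally show ?thesis .
  qed
qed

text \<open>An output configuration has nothing to the right of the head, so scratch registers have
  to be emptied as well.\<close>

definition clear_all :: "nat \<Rightarrow> cmd" where
  "clear_all N = foldr (\<lambda>i. Seq (clear i)) [0..<N] (clear 0)"

lemma regs_clear_all: "0 < N \<Longrightarrow> regs (clear_all N) \<subseteq> {..<N}"
proof -
  have "regs (foldr (\<lambda>i. Seq (clear i)) is (clear 0)) = insert 0 (set is)" for "is"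
    by (induction "is") auto
  then show "0 < N \<Longrightarrow> regs (clear_all N) \<subseteq> {..<N}" by (auto simp: clear_all_def)
qed

lemma wp_clear_all:
  "\<exists>\<tau>. (\<forall>i<N. \<tau> i = 0) \<and> wp (clear_all N) F (st, \<sigma>) = F (st, \<tau>)"
proof -
  have "\<exists>\<tau>. (\<forall>i. (i \<in> set is \<or> \<sigma> i = 0) \<longrightarrow> \<tau> i = 0) \<and>
      wp (foldr (\<lambda>i. Seq (clear i)) is (clear 0)) F (st, \<sigma>) = F (st, \<tau>)" for "is" \<sigma>
  proof (induction "is" arbitrary: \<sigma>)
    case Nil
    then show ?case by (auto intro!: exI[of _ "\<sigma>(0 := 0)"])
  next
    case (Cons i "is")
    obtain \<tau> where "\<forall>j. (j \<in> set is \<or> (\<sigma>(i := 0)) j = 0) \<longrightarrow> \<tau> j = 0"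
      "wp (foldr (\<lambda>i. Seq (clear i)) is (clear 0)) F (st, \<sigma>(i := 0)) = F (st, \<tau>)"
      using Cons[of "\<sigma>(i := 0)"] by blast
    then show ?case by (intro exI[of _ \<tau>]) auto
  qed
  from this[of "[0..<N]" \<sigma>] show ?thesis by (auto simp: clear_all_def)
qed

lemma implementable_PC:
  assumes e: "implementable k (epf_of f)" and nonneg: "\<And>xs y. length xs = k \<Longrightarrow> 0 \<le> f xs y"
  shows "PC k f"
proof -
  obtain cf where cf: "realizes cf [0..<k] k (k + 1) (epf_of f)"
    using e[unfolded implementable_def, rule_format, of "[0..<k]" "k + 1" k] by fastforce
  \<comment> \<open>Input and output share the registers above \<open>k\<close> with the scratch
    space of \<open>cf\<close>. This is safe: \<open>cf\<close> may start with any scratch contents,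
    and \<open>emit_body\<close> clears its registers before it uses them.\<close>
  define c0 where "c0 = Seq (read_args (k + 1) (k + 2) (k + 3) [0..<k])
    (Seq cf (While k (emit_body k (k + 1) (k + 2))))"
  obtain N0 where "regs c0 \<subseteq> {..<N0}"
    using finite_nat_bounded[OF finite_regs] by blast
  then obtain N where N: "regs c0 \<subseteq> {..<N}" "0 < N"
    using that[of "Suc N0"] by fastforce
  define P where "P = Seq c0 (clear_all N)"
  have P: "regs P \<subseteq> {..<N}" using N regs_clear_all[of N] by (simp add: P_def)
  have "f xs y = IO (machine N P) (enc_tuple xs) (bin_str y)" if xs: "length xs = k" for xs y
  proof -
    define F where "F = (\<lambda>s. val (machine N P) (map bsym (bits y)) (home N [] s))"
    have F: "wp (clear_all N) F (st, \<sigma>) = (if st = bits y then 1 else 0)" for st \<sigma>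
    proof -
      obtain \<tau> where "\<forall>i<N. \<tau> i = 0" "wp (clear_all N) F (st, \<sigma>) = F (st, \<tau>)"
        using wp_clear_all by blast
      then show ?thesis by (simp add: F_def val_home_Nil del: home.simps)
    qed
    have "indep (k + 1) (wp (clear_all N) F)" by (simp add: indep_def F)
    then have emit: "wp (While k (emit_body k (k + 1) (k + 2))) (wp (clear_all N) F) (st, \<sigma>) =
        (if bits (\<sigma> k) @ st = bits y then 1 else 0)" for st \<sigma>
      by (subst wp_emit) (auto simp: F)
    then have ind: "indep (k + 1) (wp (While k (emit_body k (k + 1) (k + 2))) (wp (clear_all N) F))"
      by (simp add: indep_def)
    have put: "map (put 0 xs (\<lambda>_. 0)) [0..<k] = xs"
      using map_put[OF xs, of 0 "\<lambda>_. 0"] by simp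
    have "ennreal (IO (machine N P) (enc_tuple xs) (bin_str y)) = wp P F (enc_bits xs, \<lambda>_. 0)"
      unfolding enc_tuple_bits F_def using IO_machine[OF P] by (simp add: bin_str_def map_bsym_bits)
    also have "\<dots> = wp cf (wp (While k (emit_body k (k + 1) (k + 2))) (wp (clear_all N) F))
        ([], put 0 xs (\<lambda>_. 0))"
      using wp_read_args[of 0 xs "k + 1" "k + 2" "k + 3" "\<lambda>_. 0"] xs by (simp add: P_def c0_def)
    also have "\<dots> = (\<integral>\<^sup>+z. (if z = y then 1 else 0) * ennreal (f xs z) \<partial>count_space UNIV)"
      unfolding realizesD[OF cf ind] put emit by (intro nn_integral_cong) (auto simp: bits_inj)
    also have "\<dots> = ennreal (f xs y)" by (rule nsum_point)
    finally have "ennreal (IO (machine N P) (enc_tuple xs) (bin_str y)) = ennreal (f xs y)" .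
    \<comment> \<open>\<open>ennreal\<close> is injective only on nonnegative reals.\<close>
    moreover have "0 \<le> IO (machine N P) (enc_tuple xs) (bin_str y)"
      unfolding IO_def by (rule infsum_nonneg) simp
    ultimately show ?thesis using nonneg[OF xs] by simp
  qed
  then show ?thesis unfolding PC_def using wf_machine by blast
qed

theorem mainTheorem7:
  fixes k :: nat and f :: pf
  assumes "PR k f"
  shows "PC k f"
  using PR_implementable_pf[OF assms] implementable_PC by (simp add: implementable_pf_def)

end
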